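(* Let $d\ge 1$ be an integer and let $\mu\in\mathbb{R}^d$. (i) Let $\Sigma_1\neq\Sigma_2$ be (symmetric) positive definite real $d\times d$ matrices, and let $\lambda_1,\dots,\lambda_d$ denote the eigenvalues (with multiplicity) of $\Sigma_1^{-1}\Sigma_2-I_d$. Then $$\frac{1}{100}\leq \frac{\operatorname{TV}\left(\mathcal{N}(\mu,\Sigma_1),\mathcal{N}(\mu,\Sigma_2)\right)}{\min\left\{1,\sqrt{\sum_{i=1}^{d}\lambda_i^2}\right\}}\leq \frac32 .$$ (ii) Let $\Sigma_1\neq\Sigma_2$ be (symmetric) positive semi-definite real $d\times d$ matrices with $\operatorname{range}(\Sigma_1)=\operatorname{range}(\Sigma_2)$, and let $r=\operatorname{rank}(\Sigma_1)=\operatorname{rank}(\Sigma_2)$. Let $\Pi$ be a $d\times r$ real matrix that has the same range as $\Sigma_1$ and $\Sigma_2$, and let $\rho_1,\dots,\rho_r$ denote the eigenvalues (with multiplicity) of $(\Pi^{\mathsf T}\Sigma_1\Pi)^{-1}(\Pi^{\mathsf T}\Sigma_2\Pi)-I_r$. Then $$\frac{1}{100}\leq \frac{\operatorname{TV}\left(\mathcal{N}(\mu,\Sigma_1),\mathcal{N}(\mu,\Sigma_2)\right)}{\min\left\{1,\sqrt{\sum_{i=1}^{r}\rho_i^2}\right\}}\leq \frac32 .$$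
   Context: For probability distributions $P,Q$ on $\mathbb{R}^d$, the total variation distance is $\operatorname{TV}(P,Q)=\sup_{A}|P(A)-Q(A)|$, the supremum being over (Borel) sets $A\subseteq\mathbb{R}^d$. For $\Sigma$ positive definite, $\mathcal{N}(\mu,\Sigma)$ is the Gaussian distribution on $\mathbb{R}^d$ with mean $\mu$ and covariance $\Sigma$, i.e. with density $\det(2\pi\Sigma)^{-1/2}\exp(-(x-\mu)^{\mathsf T}\Sigma^{-1}(x-\mu)/2)$. For $\Sigma$ positive semi-definite of rank $r$, let $\Pi_0$ be a $d\times r$ matrix whose columns form an orthonormal basis of $\operatorname{range}(\Sigma)$ and $\widehat\Sigma=\Pi_0^{\mathsf T}\Sigma\Pi_0$; then $\mathcal{N}(\mu,\Sigma)$ is the distribution supported on $\mu+\operatorname{range}(\Sigma)$ with density $\det(2\pi\widehat\Sigma)^{-1/2}\exp(-(x-\mu)^{\mathsf T}\Pi_0\widehat\Sigma^{-1}\Pi_0^{\mathsf T}(x-\mu)/2)$ with respect to $r$-dimensional Lebesgue measure on $\mu+\operatorname{range}(\Sigma)$ (equivalently, the law of $\mu+\Sigma^{1/2}g$ with $g\sim\mathcal{N}(0,I_d)$). The range of a matrix is its column space; $I_k$ is the $k\times k$ identity matrix. *)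

theory Defs
  imports
    "HOL-Analysis.Analysis"
    "HOL-Computational_Algebra.Polynomial"
begin

definition total_variation :: "'a::topological_space measure \<Rightarrow> 'a measure \<Rightarrow> real" where
  "total_variation P Q = (SUP A\<in>sets borel. \<bar>measure P A - measure Q A\<bar>)"

definition positive_definite :: "real^'n^'n \<Rightarrow> bool" where
  "positive_definite S \<longleftrightarrow> transpose S = S \<and> (\<forall>x. x \<noteq> 0 \<longrightarrow> 0 < x \<bullet> (S *v x))"

definition positive_semidefinite :: "real^'n^'n \<Rightarrow> bool" where
  "positive_semidefinite S \<longleftrightarrow> transpose S = S \<and> (\<forall>x. 0 \<le> x \<bullet> (S *v x))"

definition matrix_range :: "real^'n^'m \<Rightarrow> (real^'m) set" where
  "matrix_range A = span (columns A)"

definition charpoly :: "real^'n^'n \<Rightarrow> real poly" where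
  "charpoly A = det (mat [:0, 1:] - (\<chi> i j. [:A $ i $ j:]))"

(* Only real roots are counted.  For S positive definite and T symmetric,
   S^(-1) T - 1 is similar to the symmetric matrix S^(-1/2) T S^(-1/2) - 1,
   so for the matrices considered below these are all CARD('n) eigenvalues. *)
definition eigenvalues :: "real^'n^'n \<Rightarrow> real multiset" where
  "eigenvalues A = proots (charpoly A)"

definition gaussian :: "real^'n \<Rightarrow> real^'n^'n \<Rightarrow> (real^'n) measure" where
  "gaussian \<mu> S = density lborel (\<lambda>x. ennreal
     (det ((2 * pi) *\<^sub>R S) powr (- 1 / 2) *
      exp (- ((x - \<mu>) \<bullet> (matrix_inv S *v (x - \<mu>))) / 2)))"

definition orthonormal_basis_matrix :: "real^'r^'n \<Rightarrow> (real^'n) set \<Rightarrow> bool" where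
  "orthonormal_basis_matrix U V \<longleftrightarrow> transpose U ** U = mat 1 \<and> matrix_range U = V"

(* When U is an orthonormal basis matrix of a subspace V, y \<mapsto> \<mu> + U y is an isometry
   from R^r onto \<mu> + V, so this is r-dimensional Lebesgue measure on \<mu> + V,
   regarded as a Borel measure on the ambient space. *)
definition affine_lborel :: "real^'n \<Rightarrow> real^'r^'n \<Rightarrow> (real^'n) measure" where
  "affine_lborel \<mu> U = distr lborel borel (\<lambda>y. \<mu> + U *v y)"

(* The possibly degenerate Gaussian N(\<mu>, S), for S positive semidefinite of rank r = CARD('r)
   and U an orthonormal basis matrix of the range of S.  U is a parameter because it carries
   the type 'r that indexes the r x r matrix U^T S U. *)
definition degenerate_gaussian ::
    "real^'r^'n \<Rightarrow> real^'n \<Rightarrow> real^'n^'n \<Rightarrow> (real^'n) measure" where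
  "degenerate_gaussian U \<mu> S = (let S' = transpose U ** S ** U in
     density (affine_lborel \<mu> U) (\<lambda>x. ennreal
       (det ((2 * pi) *\<^sub>R S') powr (- 1 / 2) *
        exp (- ((x - \<mu>) \<bullet> ((U ** matrix_inv S' ** transpose U) *v (x - \<mu>))) / 2))))"

end

(*
  Diagonalizing both covariances simultaneously and rescaling so that the average of the two
  precision matrices becomes the identity, the two Gaussians are images under one affine bijection
  of the measures f M and g M, where M is the standard Gaussian,
  f(x) = prod_i sqrt(1 + c_i) exp(- c_i x_i^2 / 2), g is f with -c in place of c, |c_i| < 1, and
  lambda_i = 2 c_i / (1 - c_i).  Total variation is half of int |f - g| dM, and
  sqrt(f g) = B := prod_i (1 - c_i^2)^(1/4) is constant.

  Upper bound: 1 - B <= sum_i c_i^2 <= sum_i lambda_i^2, and the affinity B controls the total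
  variation from above.

  Lower bound: if B <= 99/100, use TV >= 1 - B.  Otherwise all |c_i| are at most 1/5, and
  |f - g| >= B |ln g - ln f|, where ln g - ln f differs by a constant from the centred variable
  W = sum_i c_i (x_i^2 - 1).  The second and fourth moments of W give a lower bound for E|W| of
  the order of sqrt(sum_i c_i^2).

  The degenerate case is the image of a nondegenerate one under y |-> mu + U y.
*)
theory Submission
  imports Defs "HOL-Probability.Probability"
begin

subsection \<open>Simultaneous diagonalization\<close>

text \<open>Every constant has to be free of the dimension, and total variation does not factor over
  coordinates. Two quantities behave well instead: the affinity of product measures is a product,
  and the second and fourth moments of a sum of independent centred variables stay comparable. With
  average precision 1 the exponents of f and g are opposite, so sqrt(f g) loses its dependence on x
  and the lower bound becomes a first moment of a quadratic polynomial under the standard Gaussian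
  itself.

  The price is that lambda_i = 2 c_i / (1 - c_i) is not symmetric in c_i and blows up at 1. The
  upper bound only uses |c_i| <= |lambda_i|. The lower bound needs a converse, available once c_i
  stays away from 1; a value of B near 1 supplies this, because it limits each single c_i. The
  constant 1/100 is forced by the case of small B, while the other case has room to spare. The
  constant 3/2 is (2 + 1) / 2, from one choice of weight in an arithmetic-geometric mean
  inequality.\<close>

lemma quadratic_nonneg_linear_coeff_zero:
  fixes a b :: real
  assumes "\<And>t. 0 \<le> a * t + b * t\<^sup>2"
  shows "a = 0"
proof (rule ccontr)
  assume "a \<noteq> 0"
  \<comment> \<open>The sign makes the linear term negative, and the step is short enough that the
    quadratic term cannot make up for it; adding 1 covers \<open>b = 0\<close>.\<close>
  define t where "t = - a / (\<bar>b\<bar> + 1)"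
  have "t * (\<bar>b\<bar> + 1) = - a" by (simp add: t_def)
  then have a: "a = - t * (\<bar>b\<bar> + 1)" by simp
  with \<open>a \<noteq> 0\<close> have "t\<^sup>2 > 0" by auto
  have "a * t + b * t\<^sup>2 = t\<^sup>2 * (b - \<bar>b\<bar> - 1)"
    by (simp add: a algebra_simps power2_eq_square)
  also have "\<dots> < 0" using \<open>t\<^sup>2 > 0\<close> by (intro mult_pos_neg) auto
  finally show False using assms[of t] by simp
qed

text \<open>A maximiser of x . f x on the unit sphere of V is an eigenvector, and self-adjointness
  makes its orthogonal complement in V invariant. Quantifying over invariant subspaces keeps the
  induction on the dimension inside one type.\<close>

lemma selfadjoint_orthonormal_eigenbasis:
  fixes f :: "'a::euclidean_space \<Rightarrow> 'a"
  assumes f: "linear f" and sym: "\<And>x y. x \<bullet> f y = f x \<bullet> y"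
    and V: "subspace V" "f ` V \<subseteq> V"
  shows "\<exists>B. B \<subseteq> V \<and> span B = V \<and> pairwise orthogonal B \<and>
           (\<forall>b\<in>B. norm b = 1 \<and> (\<exists>l. f b = l *\<^sub>R b))"
  using V
proof (induction "dim V" arbitrary: V rule: less_induct)
  case less
  show ?case
  proof (cases "V = {0}")
    case True
    then show ?thesis by (intro exI[of _ "{}"]) auto
  next
    case False
    define K where "K = V \<inter> sphere 0 1"
    have "compact K" unfolding K_def
      using closed_subspace[OF less.prems(1)] by (simp add: closed_Int_compact)
    moreover have "K \<noteq> {}"
    proof -
      obtain x where "x \<in> V" "x \<noteq> 0" using False subspace_0[OF less.prems(1)] by blast
      then have "(1 / norm x) *\<^sub>R x \<in> K"
        unfolding K_def using less.prems(1) by (simp add: subspace_scale)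
      then show ?thesis by blast
    qed
    moreover have "continuous_on K (\<lambda>x. x \<bullet> f x)"
      using f by (intro continuous_intros linear_continuous_on linear_conv_bounded_linear[THEN iffD1])
    ultimately obtain u where u: "u \<in> K" and max: "\<And>x. x \<in> K \<Longrightarrow> x \<bullet> f x \<le> u \<bullet> f u"
      using continuous_attains_sup by metis
    define l where "l = u \<bullet> f u"
    have uV: "u \<in> V" and nu: "norm u = 1" and uu: "u \<bullet> u = 1"
      using u by (auto simp: K_def norm_eq_1)
    \<comment> \<open>Homogeneity extends maximality from the unit sphere to all of V.\<close>
    have Q: "x \<bullet> f x \<le> l * (x \<bullet> x)" if "x \<in> V" for x
    proof (cases "x = 0")
      case True then show ?thesis by (simp add: linear_0[OF f])
    next
      case False
      then have "(1 / norm x) *\<^sub>R x \<in> K"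
        unfolding K_def using that less.prems(1) by (simp add: subspace_scale)
      from max[OF this] have "(x \<bullet> f x) / (norm x)\<^sup>2 \<le> l"
        by (simp add: l_def linear_scale[OF f] power2_eq_square)
      then show ?thesis using False
        by (simp add: divide_le_eq power2_norm_eq_inner)
    qed
    \<comment> \<open>The form l (x . x) - x . f x is nonnegative on V and vanishes at u, so its
      derivative at u in every direction w of V is zero. Taking w to be l u - f u itself then gives
      the eigenvalue equation.\<close>
    have orth: "w \<bullet> (l *\<^sub>R u - f u) = 0" if w: "w \<in> V" for w
    proof -
      have "2 * (w \<bullet> (l *\<^sub>R u - f u)) = 0"
      proof (rule quadratic_nonneg_linear_coeff_zero)
        fix t :: real
        have "u + t *\<^sub>R w \<in> V"
          using uV w less.prems(1) by (simp add: subspace_add subspace_scale)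
        from Q[OF this] have "0 \<le> l * ((u + t *\<^sub>R w) \<bullet> (u + t *\<^sub>R w)) - (u + t *\<^sub>R w) \<bullet> f (u + t *\<^sub>R w)"
          by simp
        also have "\<dots> = 2 * (w \<bullet> (l *\<^sub>R u - f u)) * t + (l * (w \<bullet> w) - w \<bullet> f w) * t\<^sup>2"
          using sym[of u w] uu
          by (simp add: linear_add[OF f] linear_scale[OF f] inner_add inner_diff_right l_def[symmetric]
                inner_commute[of u w] inner_commute[of "f u" w] algebra_simps power2_eq_square)
        finally show "0 \<le> 2 * (w \<bullet> (l *\<^sub>R u - f u)) * t + (l * (w \<bullet> w) - w \<bullet> f w) * t\<^sup>2" .
      qed
      then show ?thesis by simp
    qed
    have "l *\<^sub>R u - f u \<in> V"
      using uV less.prems by (auto intro!: subspace_diff subspace_scale)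
    from orth[OF this] have fu: "f u = l *\<^sub>R u" by simp
    define V' where "V' = V \<inter> {x. u \<bullet> x = 0}"
    have V': "subspace V'"
      unfolding V'_def using less.prems(1) subspace_hyperplane by (rule subspace_inter)
    have fV': "f ` V' \<subseteq> V'"
      using less.prems(2) by (auto simp: V'_def sym fu)
    have "V' \<subseteq> V" "u \<notin> V'" using uu by (auto simp: V'_def)
  then have "V' \<subset> V" using uV by blast
    then have "dim V' < dim V"
      using V' less.prems(1) by (simp add: dim_psubset span_eq_iff[THEN iffD2])
    from less.hyps[OF this V' fV'] obtain B where B: "B \<subseteq> V'" "span B = V'" "pairwise orthogonal B"
      "\<And>b. b \<in> B \<Longrightarrow> norm b = 1 \<and> (\<exists>l. f b = l *\<^sub>R b)" by blast
    have "x \<in> span (insert u B)" if "x \<in> V" for x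
    proof -
      have "x - (u \<bullet> x) *\<^sub>R u \<in> V'"
        using that uV uu less.prems(1)
        by (simp add: V'_def subspace_diff subspace_scale inner_diff_right)
      then show ?thesis
        using B(2) by (auto simp: span_breakdown_eq)
    qed
    moreover have "insert u B \<subseteq> V" using uV B(1) by (auto simp: V'_def)
    ultimately have "span (insert u B) = V"
      using less.prems(1) by (metis span_minimal subsetI subset_antisym)
    moreover have "pairwise orthogonal (insert u B)"
      using B(1,3) by (auto simp: pairwise_insert V'_def orthogonal_def inner_commute)
    ultimately show ?thesis
      using \<open>insert u B \<subseteq> V\<close> B(4) nu fu by (intro exI[of _ "insert u B"]) auto
  qed
qed

section \<open>Diagonal matrices and the spectral theorem\<close>

definition diagonal :: "('n \<Rightarrow> real) \<Rightarrow> real^'n^'n" where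
  "diagonal d = (\<chi> i j. if i = j then d i else 0)"

lemma diagonal_nth: "diagonal d $ i $ j = (if i = j then d i else 0)"
  by (simp add: diagonal_def)

lemma matrix_mul_diagonal_nth: "(A ** diagonal d) $ i $ j = A $ i $ j * d j"
  by (simp add: matrix_matrix_mult_def diagonal_nth if_distrib[of "\<lambda>x. _ * x"] cong: if_cong)

lemma transpose_diagonal [simp]: "transpose (diagonal d) = diagonal d"
  by (auto simp: transpose_def diagonal_def vec_eq_iff)

lemma diagonal_mul: "diagonal d ** diagonal e = diagonal (\<lambda>i. d i * e i)"
  by (simp add: vec_eq_iff matrix_mul_diagonal_nth) (simp add: diagonal_nth)

lemma diagonal_1: "diagonal (\<lambda>_. 1) = mat 1"
  by (simp add: diagonal_def mat_def)

lemma diagonal_minus_mat: "diagonal d - mat 1 = diagonal (\<lambda>i. d i - 1)"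
  by (simp add: diagonal_def mat_def vec_eq_iff)

lemma det_diagonal_eq: "det (diagonal d) = (\<Prod>i\<in>UNIV. d i)"
  by (subst det_diagonal) (auto simp: diagonal_nth)

lemma diagonal_mult_vec: "diagonal d *v x = (\<chi> i. d i * x $ i)"
  by (simp add: vec_eq_iff matrix_vector_mult_def diagonal_nth if_distrib[of "\<lambda>x. x * _"] cong: if_cong)

lemma invertible_diagonal:
  assumes "\<And>i. d i \<noteq> 0" shows "invertible (diagonal d)"
  by (simp add: invertible_det_nz det_diagonal_eq assms)

lemma symmetric_matrix_inner:
  fixes S :: "real^'n^'n"
  assumes "transpose S = S"
  shows "x \<bullet> (S *v y) = (S *v x) \<bullet> y"
  using dot_lmul_matrix[of x S y] transpose_matrix_vector[of S x] assms by simp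

theorem symmetric_matrix_diagonalization:
  fixes S :: "real^'n^'n"
  assumes "transpose S = S"
  obtains U d where "orthogonal_matrix U" "S = U ** diagonal d ** transpose U"
proof -
  obtain B where B: "span B = (UNIV :: (real^'n) set)" "pairwise orthogonal B"
    "\<And>b. b \<in> B \<Longrightarrow> norm b = 1" "\<And>b. b \<in> B \<Longrightarrow> \<exists>l. S *v b = l *\<^sub>R b"
    using selfadjoint_orthonormal_eigenbasis[of "(*v) S" UNIV] symmetric_matrix_inner[OF assms]
    by (force simp: matrix_vector_mul_linear)
  have "0 \<notin> B" using B(3) by fastforce
  have "independent B"
    using B(2) \<open>0 \<notin> B\<close> by (rule pairwise_orthogonal_independent)
  then have "card B = CARD('n)" "finite B"
    using B(1) basis_card_eq_dim[of B UNIV] by (auto simp: independent_imp_finite)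
  \<comment> \<open>Columns are indexed by the type \<open>'n\<close>, so the eigenbasis is
    enumerated by that type in order to become a matrix.\<close>
  then obtain e where e: "bij_betw e (UNIV :: 'n set) B"
    by (metis finite finite_same_card_bij)
  from B(4) obtain l where l: "\<And>b. b \<in> B \<Longrightarrow> S *v b = l b *\<^sub>R b" by metis
  have eB: "e i \<in> B" for i using e by (auto simp: bij_betw_def)
  define U :: "real^'n^'n" where "U = (\<chi> i j. e j $ i)"
  have ee: "e i \<bullet> e j = (if i = j then 1 else 0)" for i j
  proof (cases "i = j")
    case True then show ?thesis using B(3)[OF eB] by (simp add: norm_eq_1)
  next
    case False
    then have "e i \<noteq> e j" using bij_betw_imp_inj_on[OF e] by (auto dest: injD)
    then show ?thesis using False B(2) eB by (auto simp: pairwise_def orthogonal_def)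
  qed
  have UU: "transpose U ** U = mat 1"
    by (simp add: vec_eq_iff matrix_matrix_mult_def transpose_def U_def mat_def ee[symmetric] inner_vec_def)
  then have U: "orthogonal_matrix U"
    by (simp add: orthogonal_matrix)
  have "S ** U = U ** diagonal (\<lambda>i. l (e i))"
  proof -
    have "(S ** U) $ i $ j = (S *v e j) $ i" for i j
      by (simp add: matrix_matrix_mult_def matrix_vector_mult_def U_def)
    then show ?thesis
      by (simp add: vec_eq_iff matrix_mul_diagonal_nth l[OF eB]) (simp add: U_def mult.commute)
  qed
  then have "S ** U ** transpose U = U ** diagonal (\<lambda>i. l (e i)) ** transpose U" by simp
  then have "S = U ** diagonal (\<lambda>i. l (e i)) ** transpose U"
    using U by (simp add: matrix_mul_assoc[symmetric] orthogonal_matrix_def)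
  with U that show ?thesis by blast
qed

lemma inner_congruence:
  fixes A :: "real^'n^'m" and S :: "real^'m^'m"
  shows "x \<bullet> ((transpose A ** S ** A) *v x) = (A *v x) \<bullet> (S *v (A *v x))"
proof -
  have "(transpose A ** S ** A) *v x = (S *v (A *v x)) v* A"
    by (simp add: matrix_vector_mul_assoc[symmetric])
  then show ?thesis
    by (simp add: inner_commute[of x] dot_lmul_matrix) (simp add: inner_commute)
qed

lemma positive_definite_congruence:
  assumes "positive_definite S" "invertible A"
  shows "positive_definite (transpose A ** S ** A)"
proof -
  have "A *v x \<noteq> 0" if "x \<noteq> 0" for x
    using assms(2) matrix_left_invertible_ker[of A] that by (auto simp: invertible_def)
  then show ?thesis
    using assms(1) unfolding positive_definite_def
    by (simp add: inner_congruence matrix_transpose_mul matrix_mul_assoc)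
qed

lemma positive_definite_diagonalD:
  assumes "positive_definite (diagonal d)"
  shows "d i > 0"
proof -
  have "0 < axis i 1 \<bullet> (diagonal d *v axis i 1)"
    using assms by (simp add: positive_definite_def axis_eq_0_iff)
  then show ?thesis
    by (simp add: diagonal_mult_vec inner_axis_axis inner_axis')
qed

text \<open>Write S = R R^T by the spectral theorem and diagonalise R^-1 T R^-T by an orthogonal V.
  Replacing R by R V leaves R R^T unchanged, so both factorisations hold with A = R V.\<close>

lemma simultaneous_diagonalization:
  fixes S T :: "real^'n^'n"
  assumes S: "positive_definite S" and T: "positive_definite T"
  obtains A :: "real^'n^'n" and s where "invertible A" "S = A ** transpose A"
    "T = A ** diagonal s ** transpose A" "\<And>i. s i > 0"
proof -
  obtain U d where U: "orthogonal_matrix U" and SU: "S = U ** diagonal d ** transpose U"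
    using symmetric_matrix_diagonalization S by (metis positive_definite_def)
  have UU: "transpose U ** U = mat 1" "U ** transpose U = mat 1"
    using U by (auto simp: orthogonal_matrix_def)
  have iU: "invertible U" using UU by (auto simp: invertible_def)
  have "transpose U ** S ** U = (transpose U ** U) ** diagonal d ** (transpose U ** U)"
    unfolding SU by (simp only: matrix_mul_assoc)
  then have "transpose U ** S ** U = diagonal d" by (simp add: UU)
  then have d: "d i > 0" for i
    using positive_definite_congruence[OF S iU] positive_definite_diagonalD by metis
  define R where "R = U ** diagonal (\<lambda>i. sqrt (d i))"
  define R' where "R' = diagonal (\<lambda>i. 1 / sqrt (d i)) ** transpose U"
  have sd: "diagonal (\<lambda>i. sqrt (d i)) ** diagonal (\<lambda>i. 1 / sqrt (d i)) = mat 1"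
    "diagonal (\<lambda>i. 1 / sqrt (d i)) ** diagonal (\<lambda>i. sqrt (d i)) = mat 1"
    "diagonal (\<lambda>i. sqrt (d i)) ** diagonal (\<lambda>i. sqrt (d i)) = diagonal d"
    using d by (simp_all add: diagonal_mul less_imp_le order.strict_implies_not_eq[symmetric] diagonal_1[symmetric])
  have "R ** R' = U ** (diagonal (\<lambda>i. sqrt (d i)) ** diagonal (\<lambda>i. 1 / sqrt (d i))) ** transpose U"
    unfolding R_def R'_def by (simp only: matrix_mul_assoc)
  then have RR: "R ** R' = mat 1" by (simp add: sd UU)
  then have RR2: "R' ** R = mat 1" by (simp add: matrix_left_right_inverse)
  have "invertible R'" and iR: "invertible R"
    using RR RR2 by (auto simp: invertible_def)
  then have iR': "invertible (transpose R')"
    by (simp add: transpose_invertible)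
  have SR: "S = R ** transpose R"
  proof -
    have "R ** transpose R = U ** (diagonal (\<lambda>i. sqrt (d i)) ** diagonal (\<lambda>i. sqrt (d i))) ** transpose U"
      unfolding R_def by (simp only: matrix_mul_assoc matrix_transpose_mul transpose_diagonal)
    then show ?thesis by (simp add: sd SU)
  qed
  have pd: "positive_definite (R' ** T ** transpose R')"
    using positive_definite_congruence[OF T iR'] by simp
  then obtain V s where V: "orthogonal_matrix V" and TV: "R' ** T ** transpose R' = V ** diagonal s ** transpose V"
    using symmetric_matrix_diagonalization by (metis positive_definite_def)
  have VV: "transpose V ** V = mat 1" "V ** transpose V = mat 1"
    using V by (auto simp: orthogonal_matrix_def)
  have iV: "invertible V" using VV by (auto simp: invertible_def)
  have "transpose V ** (R' ** T ** transpose R') ** V = (transpose V ** V) ** diagonal s ** (transpose V ** V)"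
    unfolding TV by (simp only: matrix_mul_assoc)
  then have "transpose V ** (R' ** T ** transpose R') ** V = diagonal s" by (simp add: VV)
  then have s: "s i > 0" for i
    using positive_definite_congruence[OF pd iV] positive_definite_diagonalD by metis
  define A where "A = R ** V"
  have tRR: "transpose R' ** transpose R = mat 1"
    using RR by (metis matrix_transpose_mul transpose_mat)
  have "invertible A" unfolding A_def using iR iV by (rule invertible_mult)
  moreover have "A ** transpose A = R ** (V ** transpose V) ** transpose R"
    unfolding A_def by (simp only: matrix_transpose_mul matrix_mul_assoc)
  then have "S = A ** transpose A" by (simp add: VV SR)
  moreover have "A ** diagonal s ** transpose A = R ** (V ** diagonal s ** transpose V) ** transpose R"
    unfolding A_def by (simp only: matrix_transpose_mul matrix_mul_assoc)
  then have "A ** diagonal s ** transpose A = (R ** R') ** T ** (transpose R' ** transpose R)"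
    unfolding TV[symmetric] by (simp only: matrix_mul_assoc)
  then have "T = A ** diagonal s ** transpose A" by (simp add: RR tRR)
  ultimately show ?thesis using s that[of A s] by simp
qed

subsection \<open>Relative eigenvalues\<close>

text \<open>The constant part of the matrix inside \<open>charpoly\<close>. It is multiplicative, so
  a similarity of real matrices becomes an identity of polynomial matrices.\<close>

definition const_poly_matrix :: "real^'n^'m \<Rightarrow> real poly^'n^'m" where
  "const_poly_matrix A = (\<chi> i j. [:A $ i $ j:])"

lemma sum_const_poly: "(\<Sum>i\<in>I. [:f i:]) = [:\<Sum>i\<in>I. f i:]"
  by (induction I rule: infinite_finite_induct) simp_all

lemma const_poly_matrix_mul: "const_poly_matrix (A ** B) = const_poly_matrix A ** const_poly_matrix B"
  by (simp add: const_poly_matrix_def matrix_matrix_mult_def vec_eq_iff sum_const_poly mult.commute)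

lemma const_poly_matrix_1: "const_poly_matrix (mat 1) = mat 1"
  by (simp add: const_poly_matrix_def mat_def vec_eq_iff one_pCons)

lemma mat_mul_commute:
  fixes A :: "'a::comm_semiring_1^'n^'n"
  shows "mat k ** A = A ** mat k"
  by (simp add: vec_eq_iff matrix_matrix_mult_def mat_def mult.commute
      if_distrib[of "\<lambda>x. x * _"] if_distrib[of "\<lambda>x. _ * x"] cong: if_cong)

lemma matrix_diff_rdistrib: "(A - B) ** C = A ** C - B ** (C :: 'a::ring_1^'n^'m)"
  by (simp add: matrix_matrix_mult_def vec_eq_iff left_diff_distrib sum_subtractf)

lemma matrix_diff_ldistrib: "A ** (B - C) = A ** B - A ** (C :: 'a::ring_1^'n^'m)"
  by (simp add: matrix_matrix_mult_def vec_eq_iff right_diff_distrib sum_subtractf)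

text \<open>The scalar matrix of the indeterminate commutes with every matrix, so conjugation acts
  on the whole characteristic matrix and its determinant does not change.\<close>

lemma charpoly_similar:
  fixes A B C :: "real^'n^'n"
  assumes "B ** C = mat 1"
  shows "charpoly (B ** A ** C) = charpoly A"
proof -
  let ?k = const_poly_matrix and ?X = "mat [:0, 1:] :: real poly^'n^'n"
  have BC: "?k B ** ?k C = mat 1"
    by (simp add: assms const_poly_matrix_1 flip: const_poly_matrix_mul)
  have "?X - ?k (B ** A ** C) = ?k B ** (?X - ?k A) ** ?k C"
  proof -
    have "?k B ** ?X ** ?k C = ?X ** (?k B ** ?k C)"
      by (simp only: mat_mul_commute matrix_mul_assoc)
    then show ?thesis
      by (simp add: matrix_diff_ldistrib matrix_diff_rdistrib BC const_poly_matrix_mul)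
  qed
  then have "charpoly (B ** A ** C) = det (?k B ** (?X - ?k A) ** ?k C)"
    by (simp add: charpoly_def const_poly_matrix_def)
  also have "\<dots> = det (?X - ?k A) * det (?k B ** ?k C)"
    by (simp only: det_mul mult_ac)
  finally show ?thesis
    by (simp add: BC) (simp add: charpoly_def const_poly_matrix_def)
qed

text \<open>The characteristic polynomial splits into real linear factors here, so counting only
  real roots loses no eigenvalue.\<close>

lemma sum_eigenvalues_diagonal:
  "(\<Sum>l\<in>#eigenvalues (diagonal d). f l) = (\<Sum>i\<in>UNIV. f (d i))"
proof -
  have "charpoly (diagonal d) = (\<Prod>i\<in>UNIV. [:- d i, 1:])"
    unfolding charpoly_def by (subst det_diagonal) (auto simp: mat_def diagonal_nth intro!: prod.cong)
  then have "eigenvalues (diagonal d) = (\<Sum>i\<in>UNIV. {#d i#})"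
    by (simp add: eigenvalues_def proots_prod)
  moreover have "(\<Sum>l\<in>#(\<Sum>i\<in>I. {#d i#}). f l) = (\<Sum>i\<in>I. f (d i))" if "finite I" for I
    using that by induction auto
  ultimately show ?thesis by simp
qed

lemma matrix_inv_unique:
  fixes A B :: "real^'n^'n"
  assumes "A ** B = mat 1"
  shows "matrix_inv A = B"
proof -
  have "A ** matrix_inv A = mat 1 \<and> matrix_inv A ** A = mat 1"
    unfolding matrix_inv_def by (rule someI[of _ B]) (use assms matrix_left_right_inverse in auto)
  then show ?thesis
    using assms by (metis matrix_mul_assoc matrix_mul_lid matrix_mul_rid)
qed

lemma invertible_matrix_inv:
  fixes A :: "real^'n^'n"
  assumes "invertible A"
  shows "A ** matrix_inv A = mat 1" "matrix_inv A ** A = mat 1"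
  using assms matrix_inv_unique unfolding invertible_def by metis+

lemma matrix_inv_congruence:
  fixes A S :: "real^'n^'n"
  assumes "invertible A" "invertible S"
  shows "matrix_inv (transpose A ** S ** A) = matrix_inv A ** matrix_inv S ** matrix_inv (transpose A)"
proof (rule matrix_inv_unique)
  have "invertible (transpose A)" using assms(1) by (rule transpose_invertible)
  have "transpose A ** S ** A ** (matrix_inv A ** matrix_inv S ** matrix_inv (transpose A)) =
        transpose A ** (S ** (A ** matrix_inv A) ** matrix_inv S) ** matrix_inv (transpose A)"
    by (simp only: matrix_mul_assoc)
  then show "transpose A ** S ** A ** (matrix_inv A ** matrix_inv S ** matrix_inv (transpose A)) = mat 1"
    using assms \<open>invertible (transpose A)\<close> by (simp add: invertible_matrix_inv)
qed

text \<open>The factors A^T cancel, and what remains is the conjugate of S^-1 T - 1 by A. This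
  serves twice: to read off the eigenvalues after diagonalisation, and to remove the arbitrary
  matrix P in the degenerate case.\<close>

lemma eigenvalues_relative_congruence:
  fixes A S T :: "real^'n^'n"
  assumes "invertible A" "invertible S"
  shows "eigenvalues (matrix_inv (transpose A ** S ** A) ** (transpose A ** T ** A) - mat 1) =
         eigenvalues (matrix_inv S ** T - mat 1)"
proof -
  have "invertible (transpose A)" using assms(1) by (rule transpose_invertible)
  have "matrix_inv (transpose A ** S ** A) ** (transpose A ** T ** A) =
    matrix_inv A ** matrix_inv S ** (matrix_inv (transpose A) ** transpose A) ** T ** A"
    unfolding matrix_inv_congruence[OF assms] by (simp only: matrix_mul_assoc)
  then have "matrix_inv (transpose A ** S ** A) ** (transpose A ** T ** A) - mat 1 =
    matrix_inv A ** (matrix_inv S ** T - mat 1) ** A"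
    using assms \<open>invertible (transpose A)\<close>
    by (simp add: matrix_diff_ldistrib matrix_diff_rdistrib matrix_mul_assoc invertible_matrix_inv)
  then show ?thesis
    using assms by (simp add: eigenvalues_def charpoly_similar invertible_matrix_inv)
qed

text \<open>With \<open>S = B B\<^sup>T\<close> and \<open>T = B diag(s) B\<^sup>T\<close>, put \<open>c = (s - 1) / (s + 1)\<close> and scale the columns of \<open>B\<close>
  so that the average of the two precision matrices becomes the identity.\<close>
lemma relative_diagonalization:
  fixes S T :: "real^'n^'n"
  assumes S: "positive_definite S" and T: "positive_definite T"
  obtains A :: "real^'n^'n" and c where "invertible A" "\<And>i. \<bar>c i\<bar> < 1"
    "S = A ** diagonal (\<lambda>i. 1 / (1 + c i)) ** transpose A"
    "T = A ** diagonal (\<lambda>i. 1 / (1 - c i)) ** transpose A"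
    "(\<Sum>l\<in>#eigenvalues (matrix_inv S ** T - mat 1). l\<^sup>2) = (\<Sum>i\<in>UNIV. (2 * c i / (1 - c i))\<^sup>2)"
proof -
  obtain B :: "real^'n^'n" and s where B: "invertible B" "S = B ** transpose B"
    "T = B ** diagonal s ** transpose B" and s: "\<And>i. s i > 0"
    using simultaneous_diagonalization[OF assms] by metis
  define c where "c = (\<lambda>i. (s i - 1) / (s i + 1))"
  \<comment> \<open>In the coordinates given by \<open>B\<close> the two precisions are 1 and 1 / s,
    and \<open>v\<close> is the reciprocal of their average. Scaling the columns by sqrt v turns
    them into v = 1 + c and v / s = 1 - c.\<close>
  define v where "v = (\<lambda>i. 2 * s i / (1 + s i))"
  have s1: "s i + 1 > 0" "s i + 1 \<noteq> 0" "1 + s i \<noteq> 0" for i using s[of i] by linarith+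
  have c1: "\<bar>c i\<bar> < 1" for i
    using s[of i] by (simp add: c_def abs_if divide_simps)
  have vpos: "v i > 0" for i using s[of i] by (simp add: v_def)
  have cp: "1 + c i = v i" and cm: "1 - c i = v i / s i"
    and vc: "2 * c i / (v i / s i) = s i - 1" for i
    using s[of i] s1[of i] by (simp_all add: c_def v_def divide_simps) (simp_all add: algebra_simps)
  define A where "A = B ** diagonal (\<lambda>i. sqrt (v i))"
  have "invertible A"
    unfolding A_def using B(1) vpos by (intro invertible_mult invertible_diagonal) (auto simp: less_imp_neq[symmetric])
  moreover have A: "A ** diagonal w ** transpose A = B ** diagonal (\<lambda>i. v i * w i) ** transpose B" for w
  proof -
    have "A ** diagonal w ** transpose A =
      B ** (diagonal (\<lambda>i. sqrt (v i)) ** diagonal w ** diagonal (\<lambda>i. sqrt (v i))) ** transpose B"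
      unfolding A_def by (simp only: matrix_transpose_mul transpose_diagonal matrix_mul_assoc)
    also have "diagonal (\<lambda>i. sqrt (v i)) ** diagonal w ** diagonal (\<lambda>i. sqrt (v i)) = diagonal (\<lambda>i. v i * w i)"
      using vpos by (simp add: diagonal_mul mult.commute mult.left_commute less_imp_le flip: mult.assoc)
    finally show ?thesis .
  qed
  have "S = A ** diagonal (\<lambda>i. 1 / (1 + c i)) ** transpose A"
    unfolding A cp using vpos by (simp add: less_imp_neq[symmetric] diagonal_1 B(2))
  moreover have "T = A ** diagonal (\<lambda>i. 1 / (1 - c i)) ** transpose A"
    unfolding A cm using vpos s by (simp add: less_imp_neq[symmetric] B(3))
  moreover have "(\<Sum>l\<in>#eigenvalues (matrix_inv S ** T - mat 1). l\<^sup>2) = (\<Sum>i\<in>UNIV. (2 * c i / (1 - c i))\<^sup>2)"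
  proof -
    have "invertible (transpose B)" using B(1) by (rule transpose_invertible)
    from eigenvalues_relative_congruence[OF this, of "mat 1" "diagonal s"]
    have "eigenvalues (matrix_inv S ** T - mat 1) = eigenvalues (matrix_inv (mat 1) ** diagonal s - mat 1)"
      using invertible_diagonal[of "\<lambda>_. 1 :: real"] by (simp add: B(2,3) diagonal_1)
    also have "\<dots> = eigenvalues (diagonal (\<lambda>i. s i - 1))"
      by (simp add: matrix_inv_unique[of "mat 1" "mat 1"] diagonal_minus_mat)
    finally have "eigenvalues (matrix_inv S ** T - mat 1) = eigenvalues (diagonal (\<lambda>i. s i - 1))" .
    moreover have "2 * c i / (1 - c i) = s i - 1" for i
      by (simp only: cm vc)
    ultimately show ?thesis by (simp add: sum_eigenvalues_diagonal)
  qed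
  ultimately show ?thesis using c1 that[of A c] by simp
qed

subsection \<open>Total variation of measures with densities\<close>

lemma total_variation_distr:
  assumes M: "sets M = sets borel" "sets N = sets borel"
    and T: "T \<in> borel_measurable borel" and G: "G \<in> borel_measurable borel"
    and GT: "\<And>x. G (T x) = x"
  shows "total_variation (distr M borel T) (distr N borel T) = total_variation M N"
proof -
  have T': "T \<in> measurable M borel" "T \<in> measurable N borel"
    using T measurable_cong_sets[OF M(1) refl] measurable_cong_sets[OF M(2) refl] by auto
  have sp: "space M = UNIV" "space N = UNIV"
    using M by (auto dest!: sets_eq_imp_space_eq)
  have "(\<lambda>A. \<bar>measure (distr M borel T) A - measure (distr N borel T) A\<bar>) ` sets borel =
        (\<lambda>A. \<bar>measure M A - measure N A\<bar>) ` sets borel" (is "?l = ?r")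
  proof (intro subset_antisym subsetI)
    fix y assume "y \<in> ?l"
    then obtain A where A: "A \<in> sets borel" "y = \<bar>measure (distr M borel T) A - measure (distr N borel T) A\<bar>"
      by auto
    moreover have "T -` A \<in> sets borel" using measurable_sets[OF T A(1)] by simp
    ultimately show "y \<in> ?r"
      by (intro image_eqI[of _ _ "T -` A"]) (simp_all add: measure_distr T' sp)
  next
    fix y assume "y \<in> ?r"
    then obtain A where A: "A \<in> sets borel" "y = \<bar>measure M A - measure N A\<bar>" by auto
    have GA: "G -` A \<in> sets borel" using measurable_sets[OF G A(1)] by simp
    have "T -` (G -` A) = A" using GT by auto
    with A GA show "y \<in> ?l"
      by (intro image_eqI[of _ _ "G -` A"]) (simp_all add: measure_distr T' sp)
  qed
  then show ?thesis by (simp add: total_variation_def)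
qed

locale density_pair =
  fixes M :: "'a::topological_space measure" and f g :: "'a \<Rightarrow> real"
  assumes sets_M: "sets M = sets borel"
    and int: "integrable M f" "integrable M g"
    and nonneg: "\<And>x. 0 \<le> f x" "\<And>x. 0 \<le> g x"
    and mass: "(\<integral>x. f x \<partial>M) = 1" "(\<integral>x. g x \<partial>M) = 1"
begin

abbreviation "P \<equiv> density M (\<lambda>x. ennreal (f x))"
abbreviation "Q \<equiv> density M (\<lambda>x. ennreal (g x))"

lemma measure_density_real:
  assumes "integrable M h" "\<And>x. 0 \<le> h x" "A \<in> sets borel"
  shows "measure (density M (\<lambda>x. ennreal (h x))) A = (\<integral>x. indicator A x * h x \<partial>M)"
proof -
  have A: "A \<in> sets M" using assms sets_M by simp
  have "emeasure (density M (\<lambda>x. ennreal (h x))) A = (\<integral>\<^sup>+x. ennreal (indicator A x * h x) \<partial>M)"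
    using assms(1) A
    by (subst emeasure_density) (auto simp: indicator_def intro!: nn_integral_cong)
  also have "\<dots> = ennreal (\<integral>x. indicator A x * h x \<partial>M)"
    using assms A integrable_real_mult_indicator[OF A assms(1)]
    by (intro nn_integral_eq_integral) (auto simp: mult.commute)
  finally show ?thesis
    by (simp add: measure_def integral_nonneg_AE assms)
qed

text \<open>Both masses are 1, so f - g has integral 0 and the 1/2 may be subtracted. The weight
  then has absolute value exactly 1/2 everywhere, which yields the formula for the total variation
  at once.\<close>

lemma measure_diff:
  assumes A: "A \<in> sets borel"
  shows "measure P A - measure Q A = (\<integral>x. (indicator A x - 1 / 2) * (f x - g x) \<partial>M)"
proof -
  have A': "A \<in> sets M" using A sets_M by simp
  have i: "integrable M (\<lambda>x. indicator A x * f x)" "integrable M (\<lambda>x. indicator A x * g x)"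
    using integrable_real_mult_indicator[OF A'] int by (simp_all add: mult.commute)
  have "(\<integral>x. (indicator A x - 1 / 2) * (f x - g x) \<partial>M) =
    (\<integral>x. (indicator A x * f x - indicator A x * g x) - (1 / 2) * (f x - g x) \<partial>M)"
    by (simp add: algebra_simps)
  also have "\<dots> = (\<integral>x. indicator A x * f x \<partial>M) - (\<integral>x. indicator A x * g x \<partial>M)"
    using i int mass by simp
  finally show ?thesis
    using A int nonneg by (simp add: measure_density_real)
qed

lemma total_variation_eq: "total_variation P Q = (\<integral>x. \<bar>f x - g x\<bar> \<partial>M) / 2"
  unfolding total_variation_def
proof (rule cSup_eq_maximum)
  \<comment> \<open>On this set the weight \<open>indicator A x - 1 / 2\<close> has the sign of f -
    g, so the supremum is attained.\<close>
  define A where "A = {x \<in> space M. g x < f x}"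
  have sp: "space M = UNIV" using sets_eq_imp_space_eq[OF sets_M] by simp
  have "A \<in> sets M" unfolding A_def using int by measurable
  then have A: "A \<in> sets borel" by (simp add: sets_M)
  have "(\<integral>x. (indicator A x - 1 / 2) * (f x - g x) \<partial>M) = (\<integral>x. \<bar>f x - g x\<bar> / 2 \<partial>M)"
    by (intro Bochner_Integration.integral_cong) (auto simp: A_def sp indicator_def field_simps)
  then have "measure P A - measure Q A = (\<integral>x. \<bar>f x - g x\<bar> \<partial>M) / 2"
    using A by (simp add: measure_diff)
  moreover have "0 \<le> (\<integral>x. \<bar>f x - g x\<bar> \<partial>M)" by simp
  ultimately have "(\<integral>x. \<bar>f x - g x\<bar> \<partial>M) / 2 = \<bar>measure P A - measure Q A\<bar>" by linarith
  then show "(\<integral>x. \<bar>f x - g x\<bar> \<partial>M) / 2 \<in> (\<lambda>A. \<bar>measure P A - measure Q A\<bar>) ` sets borel"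
    using A by (rule image_eqI)
next
  fix y assume "y \<in> (\<lambda>A. \<bar>measure P A - measure Q A\<bar>) ` sets borel"
  then obtain A where A: "A \<in> sets borel" "y = \<bar>measure P A - measure Q A\<bar>" by auto
  have "y \<le> (\<integral>x. \<bar>(indicator A x - 1 / 2) * (f x - g x)\<bar> \<partial>M)"
    unfolding A(2) measure_diff[OF A(1)] by (rule integral_abs_bound)
  also have "\<dots> = (\<integral>x. \<bar>f x - g x\<bar> / 2 \<partial>M)"
    by (intro Bochner_Integration.integral_cong) (auto simp: indicator_def abs_mult)
  finally show "y \<le> (\<integral>x. \<bar>f x - g x\<bar> \<partial>M) / 2" by simp
qed

lemma total_variation_le_1: "total_variation P Q \<le> 1"
proof -
  have "(\<integral>x. \<bar>f x - g x\<bar> \<partial>M) \<le> (\<integral>x. f x + g x \<partial>M)"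
    using int nonneg by (intro integral_mono) (auto simp: abs_le_iff add_increasing add_increasing2)
  then show ?thesis using int mass by (simp add: total_variation_eq)
qed

lemma integrable_affinity: "integrable M (\<lambda>x. sqrt (f x * g x))"
proof (rule Bochner_Integration.integrable_bound)
  show "integrable M (\<lambda>x. f x + g x)" using int by simp
  show "(\<lambda>x. sqrt (f x * g x)) \<in> borel_measurable M" using int by measurable
  show "AE x in M. norm (sqrt (f x * g x)) \<le> norm (f x + g x)"
    using nonneg arith_geo_mean_sqrt[of "f x" "g x" for x] by (auto intro!: AE_I2 order_trans[OF arith_geo_mean_sqrt])
qed

text \<open>Pointwise, \<open>\<bar>f - g\<bar> = \<bar>\<surd>f - \<surd>g\<bar> (\<surd>f + \<surd>g)\<close> lies above
  \<open>(\<surd>f - \<surd>g)\<^sup>2\<close>, and below \<open>(t (\<surd>f - \<surd>g)\<^sup>2 + (\<surd>f + \<surd>g)\<^sup>2 / t) / 2\<close>.\<close>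

lemma total_variation_ge_affinity:
  "1 - (\<integral>x. sqrt (f x * g x) \<partial>M) \<le> total_variation P Q"
proof -
  have "(\<integral>x. f x + g x - 2 * sqrt (f x * g x) \<partial>M) \<le> (\<integral>x. \<bar>f x - g x\<bar> \<partial>M)"
  proof (rule integral_mono)
    fix x
    define a b where "a = sqrt (f x)" and "b = sqrt (g x)"
    have ab: "a \<ge> 0" "b \<ge> 0" "f x = a\<^sup>2" "g x = b\<^sup>2" using nonneg by (auto simp: a_def b_def)
    have "(a - b)\<^sup>2 = \<bar>a - b\<bar> * \<bar>a - b\<bar>" by (simp add: power2_eq_square)
    also have "\<dots> \<le> \<bar>a - b\<bar> * (a + b)" using ab by (intro mult_left_mono) auto
    also have "\<dots> = \<bar>a\<^sup>2 - b\<^sup>2\<bar>"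
      using ab by (simp add: power2_eq_square square_diff_square_factored abs_mult)
    finally show "f x + g x - 2 * sqrt (f x * g x) \<le> \<bar>f x - g x\<bar>"
      using ab by (simp add: real_sqrt_mult power2_diff)
  qed (use int integrable_affinity in auto)
  then show ?thesis
    using int integrable_affinity mass by (simp add: total_variation_eq)
qed

lemma total_variation_le_affinity:
  assumes t: "t > 0"
  shows "total_variation P Q \<le>
    (t * (1 - (\<integral>x. sqrt (f x * g x) \<partial>M)) + (1 + (\<integral>x. sqrt (f x * g x) \<partial>M)) / t) / 2"
proof -
  let ?B = "\<integral>x. sqrt (f x * g x) \<partial>M"
  have "(\<integral>x. \<bar>f x - g x\<bar> \<partial>M) \<le>
    (\<integral>x. (t * (f x + g x - 2 * sqrt (f x * g x)) + (f x + g x + 2 * sqrt (f x * g x)) / t) / 2 \<partial>M)"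
  proof (rule integral_mono)
    fix x
    define a b where "a = sqrt (f x)" and "b = sqrt (g x)"
    have ab: "a \<ge> 0" "b \<ge> 0" "f x = a\<^sup>2" "g x = b\<^sup>2" using nonneg by (auto simp: a_def b_def)
    have "\<bar>a\<^sup>2 - b\<^sup>2\<bar> = \<bar>a - b\<bar> * (a + b)"
      using ab by (simp add: power2_eq_square square_diff_square_factored abs_mult)
    also have "\<dots> \<le> (t * \<bar>a - b\<bar>\<^sup>2 + (a + b)\<^sup>2 / t) / 2"
    proof -
      \<comment> \<open>Keeping the weight t free does the work of the Cauchy-Schwarz inequality; t
        is fixed only when the bound is applied.\<close>
      have "0 \<le> (t * \<bar>a - b\<bar> - (a + b))\<^sup>2 / t" using t by simp
      also have "\<dots> = t * \<bar>a - b\<bar>\<^sup>2 + (a + b)\<^sup>2 / t - 2 * (\<bar>a - b\<bar> * (a + b))"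
        using t by (simp add: field_simps power2_eq_square)
      finally show ?thesis by simp
    qed
    finally show "\<bar>f x - g x\<bar> \<le>
      (t * (f x + g x - 2 * sqrt (f x * g x)) + (f x + g x + 2 * sqrt (f x * g x)) / t) / 2"
      using ab by (simp add: real_sqrt_mult power2_diff power2_sum mult.assoc)
  qed (use int integrable_affinity in auto)
  also have "\<dots> = (t * (2 - 2 * ?B) + (2 + 2 * ?B) / t) / 2"
    using int integrable_affinity mass by simp
  also have "\<dots> = t * (1 - ?B) + (1 + ?B) / t"
    using t by (simp add: field_simps)
  finally show ?thesis by (simp add: total_variation_eq)
qed

end

section \<open>Geometric and logarithmic means\<close>

lemma sinh_ge_self:
  fixes x :: real
  assumes "0 \<le> x" shows "x \<le> sinh x"
proof -
  have "sinh 0 - 0 \<le> sinh x - x"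
    using assms cosh_real_ge_1
    by (intro DERIV_nonneg_imp_nondecreasing[where f = "\<lambda>x. sinh x - x"])
       (auto intro!: derivative_eq_intros exI)
  then show ?thesis by simp
qed

text \<open>The geometric mean is at most the logarithmic mean: if y is half of ln b - ln a, then b
  - a = 2 sqrt(a b) sinh y. Applied to two densities, it bounds |f - g| below by the log-likelihood
  ratio.\<close>

lemma abs_diff_ge_geometric_mean_log:
  fixes a b :: real
  assumes "a > 0" "b > 0"
  shows "sqrt (a * b) * \<bar>ln b - ln a\<bar> \<le> \<bar>a - b\<bar>"
proof -
  have *: "sqrt (a * b) * (ln b - ln a) \<le> b - a" if "0 < a" "a \<le> b" for a b :: real
  proof -
    define y where "y = (ln b - ln a) / 2"
    have "0 \<le> y" using that by (simp add: y_def)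
    have ey: "exp y = sqrt b / sqrt a" "exp (- y) = sqrt a / sqrt b"
      using that by (simp_all add: y_def exp_diff exp_minus ln_sqrt[symmetric] diff_divide_distrib)
    have "2 * y \<le> sqrt b / sqrt a - sqrt a / sqrt b"
      using sinh_ge_self[OF \<open>0 \<le> y\<close>] unfolding sinh_field_def ey by simp
    then have "sqrt (a * b) * (2 * y) \<le> sqrt (a * b) * (sqrt b / sqrt a - sqrt a / sqrt b)"
      using that by (intro mult_left_mono) auto
    also have "\<dots> = b - a"
      using that by (simp add: real_sqrt_mult right_diff_distrib)
    finally have "sqrt (a * b) * (2 * y) \<le> b - a" .
    moreover have "2 * y = ln b - ln a" by (simp add: y_def)
    ultimately show ?thesis by simp
  qed
  show ?thesis
    using *[of a b] *[of b a] assms by (cases "a \<le> b") (auto simp: mult.commute abs_if)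
qed

subsection \<open>Moments of sums of independent variables\<close>

text \<open>A bound K on the ratio of fourth moment to squared variance survives independent centred
  sums. When Z is added to W, the odd cross terms vanish by independence and centring, and only 6
  E(Z^2) E(W^2) remains. The four conclusions form one conjunction because the induction step uses
  them together.\<close>

lemma (in prob_space) moments_indep_sum:
  fixes X :: "'i \<Rightarrow> 'a \<Rightarrow> real"
  assumes "finite I" and "indep_vars (\<lambda>_. borel) X I" and K: "K \<ge> 3"
    and "\<And>i n. i \<in> I \<Longrightarrow> integrable M (\<lambda>\<omega>. X i \<omega> ^ n)"
    and "\<And>i. i \<in> I \<Longrightarrow> expectation (X i) = 0"
    and "\<And>i. i \<in> I \<Longrightarrow> expectation (\<lambda>\<omega>. (X i \<omega>)\<^sup>2) = v i"
    and "\<And>i. i \<in> I \<Longrightarrow> expectation (\<lambda>\<omega>. X i \<omega> ^ 4) \<le> K * (v i)\<^sup>2"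
  shows "(\<forall>n. integrable M (\<lambda>\<omega>. (\<Sum>i\<in>I. X i \<omega>) ^ n)) \<and>
    expectation (\<lambda>\<omega>. \<Sum>i\<in>I. X i \<omega>) = 0 \<and>
    expectation (\<lambda>\<omega>. (\<Sum>i\<in>I. X i \<omega>)\<^sup>2) = (\<Sum>i\<in>I. v i) \<and>
    expectation (\<lambda>\<omega>. (\<Sum>i\<in>I. X i \<omega>) ^ 4) \<le> K * (\<Sum>i\<in>I. v i)\<^sup>2"
  using assms(1,2,4-)
proof (induction I rule: finite_induct)
  case empty
  then show ?case by (simp add: power_0_left)
next
  case (insert i I)
  define W where "W \<omega> = (\<Sum>i\<in>I. X i \<omega>)" for \<omega>
  have "indep_vars (\<lambda>_. borel) X I"
    using insert.prems(1) by (rule indep_vars_subset) auto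
  with insert.IH insert.prems have intW: "integrable M (\<lambda>\<omega>. W \<omega> ^ n)"
    and EW: "expectation W = 0" "expectation (\<lambda>\<omega>. (W \<omega>)\<^sup>2) = sum v I"
      "expectation (\<lambda>\<omega>. W \<omega> ^ 4) \<le> K * (sum v I)\<^sup>2" for n
    by (simp_all add: W_def[abs_def])
  define Z where "Z = X i"
  have intZ: "integrable M (\<lambda>\<omega>. Z \<omega> ^ n)" for n using insert.prems(2) by (simp add: Z_def)
  have EZ: "expectation Z = 0" "expectation (\<lambda>\<omega>. (Z \<omega>)\<^sup>2) = v i"
      "expectation (\<lambda>\<omega>. Z \<omega> ^ 4) \<le> K * (v i)\<^sup>2"
    using insert.prems by (simp_all add: Z_def)
  have indep: "indep_var borel Z borel W"
    using indep_vars_sum[OF insert.hyps insert.prems(1)] by (simp add: Z_def W_def[abs_def])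
  have indep': "indep_var borel (\<lambda>\<omega>. Z \<omega> ^ m) borel (\<lambda>\<omega>. W \<omega> ^ n)" for m n
    using indep_var_compose[OF indep, of "\<lambda>x. x ^ m" borel "\<lambda>x. x ^ n" borel] by (simp add: comp_def)
  have int: "integrable M (\<lambda>\<omega>. Z \<omega> ^ m * W \<omega> ^ n)"
    and E: "expectation (\<lambda>\<omega>. Z \<omega> ^ m * W \<omega> ^ n) =
      expectation (\<lambda>\<omega>. Z \<omega> ^ m) * expectation (\<lambda>\<omega>. W \<omega> ^ n)" for m n
    using indep_var_integrable[OF indep' intZ intW] indep_var_lebesgue_integral[OF indep' intZ intW]
    by auto
  have v: "0 \<le> v i" "0 \<le> sum v I"
    unfolding EZ(2)[symmetric] EW(2)[symmetric] by simp_all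
  have sum: "(\<Sum>j\<in>insert i I. X j \<omega>) = Z \<omega> + W \<omega>" for \<omega>
    using insert.hyps by (simp add: Z_def W_def)
  have "integrable M (\<lambda>\<omega>. (Z \<omega> + W \<omega>) ^ n)" for n
    unfolding binomial_ring by (intro Bochner_Integration.integrable_sum) (simp add: int mult.assoc)
  moreover have "expectation (\<lambda>\<omega>. Z \<omega> + W \<omega>) = 0"
    using intZ[of 1] intW[of 1] EZ(1) EW(1) by simp
  moreover have "expectation (\<lambda>\<omega>. (Z \<omega> + W \<omega>)\<^sup>2) = v i + sum v I"
  proof -
    have "expectation (\<lambda>\<omega>. (Z \<omega> + W \<omega>)\<^sup>2) =
      expectation (\<lambda>\<omega>. (Z \<omega>)\<^sup>2 + (W \<omega>)\<^sup>2 + 2 * (Z \<omega> ^ 1 * W \<omega> ^ 1))"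
      by (simp add: power2_sum mult.assoc)
    also have "\<dots> = v i + sum v I"
      using intZ intW int[of 1 1] EZ EW E[of 1 1] by simp
    finally show ?thesis .
  qed
  moreover have "expectation (\<lambda>\<omega>. (Z \<omega> + W \<omega>) ^ 4) \<le> K * (v i + sum v I)\<^sup>2"
  proof -
    have "expectation (\<lambda>\<omega>. (Z \<omega> + W \<omega>) ^ 4) =
      expectation (\<lambda>\<omega>. Z \<omega> ^ 4 + 4 * (Z \<omega> ^ 3 * W \<omega> ^ 1) + 6 * (Z \<omega> ^ 2 * W \<omega> ^ 2) +
        4 * (Z \<omega> ^ 1 * W \<omega> ^ 3) + W \<omega> ^ 4)"
      by (intro Bochner_Integration.integral_cong) (auto simp: algebra_simps power4_eq_xxxx power3_eq_cube power2_eq_square)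
    also have "\<dots> = expectation (\<lambda>\<omega>. Z \<omega> ^ 4) + 6 * (v i * sum v I) + expectation (\<lambda>\<omega>. W \<omega> ^ 4)"
      using intZ intW int[of 3 1] int[of 1 3] int[of 2 2] EZ EW E[of 3 1] E[of 1 3] E[of 2 2]
      by simp
    \<comment> \<open>The cross term fits under K (v i + sum v I)^2 because 6 <= 2 K; this is the
      role of \<open>K \<ge> 3\<close>.\<close>
    also have "\<dots> \<le> K * (v i)\<^sup>2 + 2 * K * (v i * sum v I) + K * (sum v I)\<^sup>2"
      using EZ(3) EW(3) K v by (intro add_mono mult_right_mono) auto
    finally show ?thesis by (simp add: power2_sum algebra_simps)
  qed
  ultimately show ?case
    using insert.hyps by (simp only: sum sum.insert simp_thms)
qed

text \<open>The minorant \<open>(3 u\<^sup>2 - u\<^sup>4) / 2\<close> of \<open>u \<ge> 0\<close> touches it at \<open>u = 1\<close>; apply it to \<open>u = \<bar>w\<bar> / t\<close>.\<close>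
lemma (in prob_space) expectation_abs_ge:
  assumes "integrable M W" "integrable M (\<lambda>\<omega>. (W \<omega>)\<^sup>2)" "integrable M (\<lambda>\<omega>. W \<omega> ^ 4)" and t: "t > (0::real)"
  shows "(3 * expectation (\<lambda>\<omega>. (W \<omega>)\<^sup>2) / t - expectation (\<lambda>\<omega>. W \<omega> ^ 4) / t ^ 3) / 2
    \<le> expectation (\<lambda>\<omega>. \<bar>W \<omega>\<bar>)"
proof -
  have "expectation (\<lambda>\<omega>. (3 * (W \<omega>)\<^sup>2 / t - W \<omega> ^ 4 / t ^ 3) / 2) \<le> expectation (\<lambda>\<omega>. \<bar>W \<omega>\<bar>)"
  proof (rule integral_mono)
    fix \<omega>
    define u where "u = \<bar>W \<omega>\<bar> / t"
    have u: "u \<ge> 0" "\<bar>W \<omega>\<bar> = t * u" using t by (simp_all add: u_def)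
    have "0 \<le> u * ((u - 1)\<^sup>2 * (u + 2))" using u by simp
    also have "\<dots> = 2 * u - (3 * u\<^sup>2 - u ^ 4)"
      by (simp add: algebra_simps power2_eq_square power4_eq_xxxx)
    finally have "(3 * u\<^sup>2 - u ^ 4) / 2 \<le> u" by simp
    then have "t * ((3 * u\<^sup>2 - u ^ 4) / 2) \<le> t * u" using t by (intro mult_left_mono) auto
    moreover have "(W \<omega>)\<^sup>2 = (t * u)\<^sup>2" "W \<omega> ^ 4 = (t * u) ^ 4"
      using power_even_abs[of 2 "W \<omega>"] power_even_abs[of 4 "W \<omega>"] by (simp_all add: u(2))
    then have "(3 * (W \<omega>)\<^sup>2 / t - W \<omega> ^ 4 / t ^ 3) / 2 = t * ((3 * u\<^sup>2 - u ^ 4) / 2)"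
      using t by (simp add: field_simps power2_eq_square power4_eq_xxxx power3_eq_cube)
    ultimately show "(3 * (W \<omega>)\<^sup>2 / t - W \<omega> ^ 4 / t ^ 3) / 2 \<le> \<bar>W \<omega>\<bar>" by (simp only: u(2))
  qed (use assms in auto)
  then show ?thesis using assms by simp
qed

text \<open>Since W is centred, |c| = |E(W + c)| <= E|W + c|. A factor 2 thus buys independence from
  the additive constant of the log-likelihood ratio, which never has to be estimated.\<close>

lemma (in prob_space) expectation_abs_shift:
  assumes "integrable M W" "expectation W = (0::real)"
  shows "expectation (\<lambda>\<omega>. \<bar>W \<omega>\<bar>) \<le> 2 * expectation (\<lambda>\<omega>. \<bar>W \<omega> + c\<bar>)"
proof -
  have "\<bar>c\<bar> = \<bar>expectation (\<lambda>\<omega>. W \<omega> + c)\<bar>" using assms by (simp add: prob_space)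
  also have "\<dots> \<le> expectation (\<lambda>\<omega>. \<bar>W \<omega> + c\<bar>)" by (rule integral_abs_bound)
  finally have c: "\<bar>c\<bar> \<le> expectation (\<lambda>\<omega>. \<bar>W \<omega> + c\<bar>)" .
  have "expectation (\<lambda>\<omega>. \<bar>W \<omega>\<bar>) \<le> expectation (\<lambda>\<omega>. \<bar>W \<omega> + c\<bar> + \<bar>c\<bar>)"
    using assms by (intro integral_mono) auto
  also have "\<dots> = expectation (\<lambda>\<omega>. \<bar>W \<omega> + c\<bar>) + \<bar>c\<bar>"
    using assms by (simp add: prob_space)
  finally show ?thesis using c by simp
qed

section \<open>Moments of the standard normal law and of its centred square\<close>

abbreviation "std_normal \<equiv> density lborel (\<lambda>x. ennreal (std_normal_density x))"

lemma prob_space_std_normal: "prob_space std_normal"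
  by (rule prob_space_normal_density) simp

lemma std_normal_integral:
  assumes "f \<in> borel_measurable borel"
  shows "(\<integral>x. f x \<partial>std_normal) = (\<integral>x. std_normal_density x * f x \<partial>lborel)"
  using assms by (subst integral_density) auto

lemma std_normal_integrable:
  assumes "f \<in> borel_measurable borel"
  shows "integrable std_normal f \<longleftrightarrow> integrable lborel (\<lambda>x. std_normal_density x * f x)"
  using assms by (subst integrable_density) auto

lemma std_normal_integrable_power: "integrable std_normal (\<lambda>x. x ^ k)"
  using integrable_std_normal_moment[of k] by (simp add: std_normal_integrable)

lemma std_normal_even_moment: "(\<integral>x. x ^ (2 * k) \<partial>std_normal) = fact (2 * k) / (2 ^ k * fact k)"
  using integral_std_normal_moment_even[of k] by (simp add: std_normal_integral)

text \<open>Expansion in the even moments 1, 3, 15, 105. As 60 c^4 = 15 (2 c^2)^2, the moment ratio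
  needed for sums is 15.\<close>

lemma std_normal_chi_square:
  shows "integrable std_normal (\<lambda>x. (c * (x\<^sup>2 - 1)) ^ n)"
    and "(\<integral>x. c * (x\<^sup>2 - 1) \<partial>std_normal) = 0"
    and "(\<integral>x. (c * (x\<^sup>2 - 1))\<^sup>2 \<partial>std_normal) = 2 * c\<^sup>2"
    and "(\<integral>x. (c * (x\<^sup>2 - 1)) ^ 4 \<partial>std_normal) = 60 * c ^ 4"
proof -
  interpret prob_space std_normal by (rule prob_space_std_normal)
  have s1: "(\<integral>x. 1 \<partial>std_normal) = (1::real)" using prob_space by simp
  note i = std_normal_integrable_power
  have m: "(\<integral>x. x ^ 2 \<partial>std_normal) = 1" "(\<integral>x. x ^ 4 \<partial>std_normal) = 3"
    "(\<integral>x. x ^ 6 \<partial>std_normal) = 15" "(\<integral>x. x ^ 8 \<partial>std_normal) = 105"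
    using std_normal_even_moment[of 1] std_normal_even_moment[of 2]
      std_normal_even_moment[of 3] std_normal_even_moment[of 4]
    by (simp_all add: fact_numeral)
  show "integrable std_normal (\<lambda>x. (c * (x\<^sup>2 - 1)) ^ n)"
    unfolding power_mult_distrib diff_conv_add_uminus binomial_ring
    by (intro integrable_mult_right Bochner_Integration.integrable_sum integrable_mult_left)
      (simp add: i flip: power_mult)
  show "(\<integral>x. c * (x\<^sup>2 - 1) \<partial>std_normal) = 0"
    using i[of 2] m s1 by simp
  have "(\<integral>x. (x\<^sup>2 - 1)\<^sup>2 \<partial>std_normal) = (\<integral>x. x ^ 4 - 2 * x ^ 2 + 1 \<partial>std_normal)"
    by (simp add: algebra_simps power2_eq_square power4_eq_xxxx)
  also have "\<dots> = 2" using i m s1 by simp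
  finally show "(\<integral>x. (c * (x\<^sup>2 - 1))\<^sup>2 \<partial>std_normal) = 2 * c\<^sup>2"
    by (simp add: power_mult_distrib)
  have "(\<integral>x. (x\<^sup>2 - 1) ^ 4 \<partial>std_normal) = (\<integral>x. x ^ 8 - 4 * x ^ 6 + 6 * x ^ 4 - 4 * x ^ 2 + 1 \<partial>std_normal)"
    by (intro Bochner_Integration.integral_cong) (auto simp: algebra_simps eval_nat_numeral)
  also have "\<dots> = 60" using i m s1 by simp
  finally show "(\<integral>x. (c * (x\<^sup>2 - 1)) ^ 4 \<partial>std_normal) = 60 * c ^ 4"
    by (simp add: power_mult_distrib)
qed

subsection \<open>Linear images of Lebesgue measure\<close>

lemma nn_integral_lborel_translate:
  fixes f :: "'a::euclidean_space \<Rightarrow> ennreal"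
  assumes [measurable]: "f \<in> borel_measurable borel"
  shows "(\<integral>\<^sup>+x. f (x + c) \<partial>lborel) = (\<integral>\<^sup>+x. f x \<partial>lborel)"
proof -
  have "(\<integral>\<^sup>+x. f x \<partial>lborel) = (\<integral>\<^sup>+x. f x \<partial>distr lborel borel ((+) c))"
    by (simp add: lborel_distr_plus)
  also have "\<dots> = (\<integral>\<^sup>+x. f (x + c) \<partial>lborel)"
    by (subst nn_integral_distr) (auto simp: add.commute)
  finally show ?thesis by simp
qed

text \<open>The library's \<open>measure_linear_image\<close> is restricted to well-ordered index types.
  Translation invariance determines \<open>lborel\<close> up to a constant factor, and the unit ball \<open>B\<close>,
  which \<open>f\<close> preserves, shows that this factor is 1: the computation evaluates
  \<open>\<integral>\<integral> g (f x) 1\<^sub>B(y) dx dy\<close> in two ways.\<close>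
lemma lborel_distr_orthogonal_transformation:
  fixes f :: "'a::euclidean_space \<Rightarrow> 'a"
  assumes f: "orthogonal_transformation f"
  shows "distr lborel borel f = lborel"
proof -
  have lin: "linear f" and norm: "\<And>x. norm (f x) = norm x"
    using f by (auto simp: orthogonal_transformation)
  have f_meas [measurable]: "f \<in> borel_measurable borel"
    using lin by (intro borel_measurable_continuous_onI linear_continuous_on) (simp add: linear_conv_bounded_linear)
  define f' where "f' = inv f"
  have f': "f (f' x) = x" for x
    using orthogonal_transformation_surj[OF f] by (simp add: f'_def surj_f_inv_f)
  define h :: "'a \<Rightarrow> ennreal" where "h = indicator (ball 0 1)"
  have h_meas [measurable]: "h \<in> borel_measurable borel"
    unfolding h_def by (intro borel_measurable_indicator) simp
  define b where "b = (\<integral>\<^sup>+x. h x \<partial>lborel)"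
  have b: "b \<noteq> 0" "b \<noteq> \<infinity>"
    using emeasure_lborel_ball_finite[of "0::'a" 1] content_ball_pos[of 1 "0::'a"]
    by (auto simp: b_def h_def measure_def[of lborel "ball 0 1"] simp del: content_ball_gt_0_iff)
  have fy: "f (x + f' y) = f x + y" for x y using f' lin by (simp add: linear_add)
  have hf: "h (y - f x) = h (x + - f' y)" for x y
  proof -
    have "norm (y - f x) = norm (f (f' y - x))" using f' lin by (simp add: linear_diff)
    also have "\<dots> = norm (x + - f' y)" by (simp add: norm norm_minus_commute)
    finally show ?thesis by (simp add: h_def indicator_def)
  qed
  have *: "(\<integral>\<^sup>+x. g (f x) \<partial>lborel) = (\<integral>\<^sup>+x. g x \<partial>lborel)"
    if [measurable]: "g \<in> borel_measurable borel" for g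
  proof -
    have "(\<integral>\<^sup>+x. g (f x) \<partial>lborel) * b = (\<integral>\<^sup>+y. (\<integral>\<^sup>+x. g (f x) \<partial>lborel) * h y \<partial>lborel)"
      unfolding b_def by (subst nn_integral_cmult) auto
    also have "\<dots> = (\<integral>\<^sup>+y. \<integral>\<^sup>+x. g (f x + y) * h y \<partial>lborel \<partial>lborel)"
    proof (rule nn_integral_cong)
      fix y
      have "(\<integral>\<^sup>+x. g (f x) \<partial>lborel) = (\<integral>\<^sup>+x. g (f (x + f' y)) \<partial>lborel)"
        by (intro nn_integral_lborel_translate[symmetric]) simp
      then show "(\<integral>\<^sup>+x. g (f x) \<partial>lborel) * h y = (\<integral>\<^sup>+x. g (f x + y) * h y \<partial>lborel)"
        by (simp add: fy nn_integral_multc)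
    qed
    also have "\<dots> = (\<integral>\<^sup>+x. \<integral>\<^sup>+y. g (f x + y) * h y \<partial>lborel \<partial>lborel)"
      by (rule lborel_pair.Fubini') simp
    \<comment> \<open>Translating y by f x moves the dependence on f from g to the ball, where norm
      preservation (\<open>hf\<close>) turns it into a translation of x.\<close>
    also have "\<dots> = (\<integral>\<^sup>+x. \<integral>\<^sup>+y. g y * h (y - f x) \<partial>lborel \<partial>lborel)"
    proof (rule nn_integral_cong)
      fix x
      show "(\<integral>\<^sup>+y. g (f x + y) * h y \<partial>lborel) = (\<integral>\<^sup>+y. g y * h (y - f x) \<partial>lborel)"
        using nn_integral_lborel_translate[of "\<lambda>y. g y * h (y - f x)" "f x"] by (simp add: add.commute)
    qed
    also have "\<dots> = (\<integral>\<^sup>+y. \<integral>\<^sup>+x. g y * h (y - f x) \<partial>lborel \<partial>lborel)"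
      by (rule lborel_pair.Fubini') simp
    also have "\<dots> = (\<integral>\<^sup>+y. g y * b \<partial>lborel)"
      unfolding hf b_def
      by (rule nn_integral_cong) (simp add: nn_integral_cmult nn_integral_lborel_translate del: add_uminus_conv_diff)
    also have "\<dots> = (\<integral>\<^sup>+y. g y \<partial>lborel) * b" by (rule nn_integral_multc) simp
    finally show ?thesis using b by (simp add: ennreal_mult_cancel_left mult.commute[of _ b])
  qed
  show ?thesis
  proof (rule measure_eqI)
    fix A assume "A \<in> sets (distr lborel borel f)"
    then have A [measurable]: "A \<in> sets borel" by simp
    have "(\<integral>\<^sup>+x. indicator A (f x) \<partial>lborel) = (\<integral>\<^sup>+x. indicator A x \<partial>distr lborel borel f)"
      by (rule nn_integral_distr[symmetric]) simp_all
    also have "\<dots> = emeasure (distr lborel borel f) A"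
      by (rule nn_integral_indicator) simp
    finally show "emeasure (distr lborel borel f) A = emeasure lborel A"
      by (simp add: *)
  qed simp
qed

text \<open>Diagonalise A^T A by W; the columns of A W are then orthogonal, and dividing them by
  their lengths e gives U. This reduces linear changes of variables to orthogonal and diagonal
  ones.\<close>

lemma singular_value_decomposition:
  fixes A :: "real^'n^'n"
  assumes A: "invertible A"
  obtains U V :: "real^'n^'n" and e where "orthogonal_matrix U" "orthogonal_matrix V"
    "\<And>i. e i > 0" "A = U ** diagonal e ** V"
proof -
  have "positive_definite (mat 1 :: real^'n^'n)"
    by (simp add: positive_definite_def)
  from positive_definite_congruence[OF this A]
  have pd: "positive_definite (transpose A ** A)" by simp
  then obtain W d where W: "orthogonal_matrix W"
    and AA: "transpose A ** A = W ** diagonal d ** transpose W"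
    using symmetric_matrix_diagonalization by (metis positive_definite_def)
  have WW: "transpose W ** W = mat 1" "W ** transpose W = mat 1"
    using W by (auto simp: orthogonal_matrix_def)
  then have iW: "invertible W" by (auto simp: invertible_def)
  have "transpose W ** (transpose A ** A) ** W = (transpose W ** W) ** diagonal d ** (transpose W ** W)"
    unfolding AA by (simp only: matrix_mul_assoc)
  then have *: "transpose W ** (transpose A ** A) ** W = diagonal d" by (simp add: WW)
  then have d: "d i > 0" for i
    using positive_definite_congruence[OF pd iW] positive_definite_diagonalD by metis
  define e where "e = (\<lambda>i. sqrt (d i))"
  define E where "E = diagonal (\<lambda>i. 1 / e i)"
  have e: "e i > 0" "e i * e i = d i" for i using d[of i] by (auto simp: e_def)
  have eE: "diagonal e ** E = mat 1" "E ** diagonal e = mat 1" "E ** diagonal d ** E = mat 1"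
    using e(1) e(2)[symmetric] by (simp_all add: E_def diagonal_mul less_imp_neq[symmetric] diagonal_1[symmetric])
  define U where "U = A ** W ** E"
  have "transpose U ** U = E ** (transpose W ** (transpose A ** A) ** W) ** E"
    unfolding U_def E_def by (simp only: matrix_transpose_mul transpose_diagonal matrix_mul_assoc)
  then have "orthogonal_matrix U" by (simp add: * eE orthogonal_matrix)
  moreover have "orthogonal_matrix (transpose W)" using W by (simp add: orthogonal_matrix_transpose)
  moreover have "U ** diagonal e ** transpose W = A ** W ** (E ** diagonal e) ** transpose W"
    unfolding U_def by (simp only: matrix_mul_assoc)
  then have "A = U ** diagonal e ** transpose W"
    by (simp add: eE WW flip: matrix_mul_assoc)
  ultimately show ?thesis using e(1) that by blast
qed

lemma matrix_vector_mult_measurable [measurable]: "(*v) (A :: real^'n^'m) \<in> borel_measurable borel"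
  by (intro borel_measurable_continuous_onI linear_continuous_on)
    (simp add: linear_conv_bounded_linear[symmetric] matrix_vector_mul_linear)

lemma lborel_distr_orthogonal_matrix:
  fixes U :: "real^'n^'n"
  assumes "orthogonal_matrix U"
  shows "distr lborel borel ((*v) U) = lborel"
  using assms by (intro lborel_distr_orthogonal_transformation) (simp add: orthogonal_transformation_matrix matrix_vector_mul_linear)

lemma lborel_diagonal:
  fixes d :: "'n::finite \<Rightarrow> real"
  assumes "\<And>i. d i \<noteq> 0"
  shows "lborel = density (distr lborel borel ((*v) (diagonal d))) (\<lambda>_. ennreal \<bar>det (diagonal d)\<bar>)"
proof -
  \<comment> \<open>The affine image theorem for Euclidean spaces takes scaling factors indexed by
    basis vectors; \<open>c\<close> reads d through the injection i |->
    \<open>axis i 1\<close>.\<close>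
  define c where "c b = d (THE i. b = axis i (1::real))" for b
  have c: "c (axis i 1) = d i" for i
    by (simp add: c_def axis_eq_axis)
  have Basis: "Basis = range (\<lambda>i. axis i (1::real) :: real^'n)"
    by (auto simp: Basis_vec_def)
  have inj: "inj (\<lambda>i. axis i (1::real) :: real^'n)" by (auto simp: inj_def axis_eq_axis)
  have "0 + (\<Sum>j\<in>Basis. (c j * (x \<bullet> j)) *\<^sub>R j) = diagonal d *v x" for x :: "real^'n"
  proof -
    have "0 + (\<Sum>j\<in>Basis. (c j * (x \<bullet> j)) *\<^sub>R j) = (\<Sum>i\<in>UNIV. (d i * x $ i) *\<^sub>R axis i 1)"
      by (simp add: Basis sum.reindex[OF inj] c inner_axis)
    also have "\<dots> = diagonal d *v x"
      by (simp add: vec_eq_iff diagonal_mult_vec axis_def if_distrib[of "\<lambda>x. _ * x"] cong: if_cong)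
    finally show ?thesis .
  qed
  moreover have "(\<Prod>j\<in>Basis. \<bar>c j\<bar>) = \<bar>det (diagonal d)\<bar>"
    by (simp add: Basis prod.reindex[OF inj] c det_diagonal_eq abs_prod)
  moreover have "c j \<noteq> 0" if "j \<in> Basis" for j :: "real^'n"
    using that assms by (auto simp: Basis c)
  ultimately show ?thesis
    using lborel_affine_euclidean[of c "0 :: real^'n"] by simp
qed

lemma det_orthogonal_abs: "orthogonal_matrix (U :: real^'n^'n) \<Longrightarrow> \<bar>det U\<bar> = 1"
  using det_orthogonal_matrix[of U] by auto

text \<open>Of the factors of A only the diagonal one changes volume, and its determinant agrees
  with that of A up to sign. Having \<open>lborel\<close> alone on the left lets the equation
  replace the base measure of a Gaussian.\<close>

lemma lborel_affine_matrix:
  fixes A :: "real^'n^'n" and \<mu> :: "real^'n"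
  assumes A: "invertible A"
  shows "lborel = density (distr lborel borel (\<lambda>x. \<mu> + A *v x)) (\<lambda>_. ennreal \<bar>det A\<bar>)"
proof -
  obtain U V :: "real^'n^'n" and e where U: "orthogonal_matrix U" and V: "orthogonal_matrix V"
    and e: "\<And>i. e i > 0" and A_eq: "A = U ** diagonal e ** V"
    using singular_value_decomposition[OF A] by metis
  have det: "\<bar>det A\<bar> = \<bar>det (diagonal e)\<bar>"
    using U V by (simp add: A_eq det_mul abs_mult det_orthogonal_abs)
  have fn: "(\<lambda>x. \<mu> + A *v x) = (\<lambda>x. \<mu> + x) \<circ> ((*v) U \<circ> ((*v) (diagonal e) \<circ> (*v) V))"
    by (simp add: fun_eq_iff A_eq matrix_vector_mul_assoc matrix_mul_assoc)
  have "distr lborel borel (\<lambda>x. \<mu> + A *v x) =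
    distr (distr (distr (distr lborel borel ((*v) V)) borel ((*v) (diagonal e))) borel ((*v) U)) borel (\<lambda>x. \<mu> + x)"
    unfolding fn by (simp add: distr_distr)
  also have "distr lborel borel ((*v) V) = lborel" by (rule lborel_distr_orthogonal_matrix[OF V])
  finally have D: "distr lborel borel (\<lambda>x. \<mu> + A *v x) =
    distr (distr (distr lborel borel ((*v) (diagonal e))) borel ((*v) U)) borel (\<lambda>x. \<mu> + x)" .
  have "density (distr lborel borel (\<lambda>x. \<mu> + A *v x)) (\<lambda>_. ennreal \<bar>det A\<bar>) =
    distr (distr (density (distr lborel borel ((*v) (diagonal e))) (\<lambda>_. ennreal \<bar>det A\<bar>)) borel ((*v) U)) borel (\<lambda>x. \<mu> + x)"
    unfolding D by (simp add: density_distr)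
  also have "density (distr lborel borel ((*v) (diagonal e))) (\<lambda>_. ennreal \<bar>det A\<bar>) = lborel"
    using lborel_diagonal[of e] e by (simp add: det less_imp_neq[symmetric])
  also have "distr lborel borel ((*v) U) = lborel" by (rule lborel_distr_orthogonal_matrix[OF U])
  also have "distr lborel borel (\<lambda>x. \<mu> + x) = lborel" by (rule lborel_distr_plus)
  finally show ?thesis by simp
qed

subsection \<open>Gaussians as reweighted images of the standard Gaussian\<close>

lemma vec_lambda_measurable [measurable]:
  "vec_lambda \<in> measurable (PiM UNIV (\<lambda>_. lborel)) (borel :: (real^'n::finite) measure)"
proof -
  have "(\<lambda>f. \<Sum>i\<in>UNIV. f i *\<^sub>R axis i 1) \<in> measurable (PiM UNIV (\<lambda>_. lborel)) (borel :: (real^'n) measure)"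
    by measurable
  moreover have "(\<lambda>f. \<Sum>i\<in>UNIV. f i *\<^sub>R axis i 1) = (vec_lambda :: _ \<Rightarrow> real^'n)"
    by (simp add: fun_eq_iff vec_eq_iff axis_def if_distrib[of "\<lambda>x. _ * x"] cong: if_cong)
  ultimately show ?thesis by simp
qed

text \<open>A bridge from vectors to functions: the product measure on functions is where Fubini for
  finite products and independence of coordinates are available.\<close>

lemma lborel_eq_distr_PiM:
  "lborel = distr (PiM UNIV (\<lambda>_. lborel)) (borel :: (real^'n::finite) measure) vec_lambda"
proof (rule lborel_eqI)
  fix l u :: "real^'n" assume le: "\<And>b. b \<in> Basis \<Longrightarrow> l \<bullet> b \<le> u \<bullet> b"
  then have le': "l $ i \<le> u $ i" for i
    using le[of "axis i 1"] by (simp add: inner_axis axis_in_Basis_iff)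
  interpret product_sigma_finite "\<lambda>_::'n. lborel :: real measure" ..
  have "vec_lambda -` box l u \<inter> space (PiM UNIV (\<lambda>_. lborel)) = (\<Pi>\<^sub>E i\<in>UNIV. {l $ i <..< u $ i})"
    by (auto simp: space_PiM mem_box_cart PiE_iff)
  then have "emeasure (distr (PiM UNIV (\<lambda>_. lborel)) borel vec_lambda) (box l u) = (\<Prod>i\<in>UNIV. ennreal (u $ i - l $ i))"
    by (simp add: emeasure_distr emeasure_PiM le')
  also have "\<dots> = (\<Prod>i\<in>UNIV. u $ i - l $ i)" by (simp add: prod_ennreal le')
  also have "(\<Prod>i\<in>UNIV. u $ i - l $ i) = (\<Prod>b\<in>Basis. (u - l) \<bullet> b)"
  proof -
    have inj: "inj (\<lambda>i. axis i (1::real) :: real^'n)" by (auto simp: inj_def axis_eq_axis)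
    have Basis: "Basis = range (\<lambda>i. axis i (1::real) :: real^'n)" by (auto simp: Basis_vec_def)
    show ?thesis by (simp add: Basis prod.reindex[OF inj] inner_axis)
  qed
  finally show "emeasure (distr (PiM UNIV (\<lambda>_. lborel)) borel vec_lambda) (box l u) = (\<Prod>b\<in>Basis. (u - l) \<bullet> b)" .
qed simp

lemma density_PiM:
  fixes f :: "'i::finite \<Rightarrow> 'a \<Rightarrow> ennreal"
  assumes M: "\<And>i. sigma_finite_measure (M i)" "\<And>i. sigma_finite_measure (density (M i) (f i))"
    and f [measurable]: "\<And>i. f i \<in> borel_measurable (M i)"
  shows "density (PiM UNIV M) (\<lambda>x. \<Prod>i\<in>UNIV. f i (x i)) = PiM UNIV (\<lambda>i. density (M i) (f i))"
proof -
  interpret M: product_sigma_finite M using M(1) by (simp add: product_sigma_finite_def)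
  interpret D: product_sigma_finite "\<lambda>i. density (M i) (f i)" using M(2) by (simp add: product_sigma_finite_def)
  show ?thesis
  proof (rule D.PiM_eqI)
    show "sets (density (PiM UNIV M) (\<lambda>x. \<Prod>i\<in>UNIV. f i (x i))) = sets (PiM UNIV (\<lambda>i. density (M i) (f i)))"
      by (simp cong: sets_PiM_cong)
  next
    fix A assume "\<And>i. i \<in> UNIV \<Longrightarrow> A i \<in> sets (density (M i) (f i))"
    then have A [measurable]: "A i \<in> sets (M i)" for i by simp
    have ind: "indicator (PiE UNIV A) x = (\<Prod>i\<in>UNIV. indicator (A i) (x i) :: ennreal)" for x :: "'i \<Rightarrow> 'a"
      by (auto simp: indicator_def PiE_iff prod_zero_iff)
    have "emeasure (density (PiM UNIV M) (\<lambda>x. \<Prod>i\<in>UNIV. f i (x i))) (PiE UNIV A) =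
      (\<integral>\<^sup>+x. (\<Prod>i\<in>UNIV. f i (x i) * indicator (A i) (x i)) \<partial>PiM UNIV M)"
      by (subst emeasure_density) (auto simp: ind prod.distrib intro!: sets_PiM_I_finite)
    also have "\<dots> = (\<Prod>i\<in>UNIV. \<integral>\<^sup>+x. f i x * indicator (A i) x \<partial>M i)"
      by (rule M.product_nn_integral_prod) auto
    also have "\<dots> = (\<Prod>i\<in>UNIV. emeasure (density (M i) (f i)) (A i))"
      by (simp add: emeasure_density)
    finally show "emeasure (density (PiM UNIV M) (\<lambda>x. \<Prod>i\<in>UNIV. f i (x i))) (PiE UNIV A) =
      (\<Prod>i\<in>UNIV. emeasure (density (M i) (f i)) (A i))" .
  qed simp
qed

text \<open>Defined as the image of a product measure, so that the coordinates are independent by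
  construction; the Lebesgue density is derived from this.\<close>

definition std_gaussian :: "(real^'n::finite) measure" where
  "std_gaussian = distr (PiM UNIV (\<lambda>_. std_normal)) borel vec_lambda"

lemma vec_lambda_measurable_std_normal [measurable]:
  "vec_lambda \<in> measurable (PiM UNIV (\<lambda>_. std_normal)) (borel :: (real^'n::finite) measure)"
proof -
  have "sets (PiM UNIV (\<lambda>_::'n. std_normal)) = sets (PiM UNIV (\<lambda>_. lborel))"
    by (rule sets_PiM_cong) auto
  then show ?thesis using vec_lambda_measurable measurable_cong_sets by blast
qed

lemma std_gaussian_eq_density:
  "std_gaussian = density (lborel :: (real^'n::finite) measure) (\<lambda>x. \<Prod>i\<in>UNIV. ennreal (std_normal_density (x $ i)))"
proof -
  have "density (lborel :: (real^'n) measure) (\<lambda>x. \<Prod>i\<in>UNIV. ennreal (std_normal_density (x $ i))) =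
    distr (density (PiM UNIV (\<lambda>_. lborel)) (\<lambda>x. \<Prod>i\<in>UNIV. ennreal (std_normal_density (x i)))) borel vec_lambda"
    by (subst lborel_eq_distr_PiM) (simp add: density_distr)
  also have "density (PiM UNIV (\<lambda>_::'n. lborel)) (\<lambda>x. \<Prod>i\<in>UNIV. ennreal (std_normal_density (x i))) = PiM UNIV (\<lambda>_. std_normal)"
    by (rule density_PiM)
      (auto intro: prob_space_imp_sigma_finite prob_space_std_normal sigma_finite_lborel)
  finally show ?thesis by (simp add: std_gaussian_def)
qed

text \<open>The density of the centred Gaussian with precision matrix diag(w) relative to the
  standard Gaussian.\<close>

definition reweight :: "('n::finite \<Rightarrow> real) \<Rightarrow> real^'n \<Rightarrow> real" where
  "reweight w x = (\<Prod>i\<in>UNIV. sqrt (w i) * exp ((1 - w i) * (x $ i)\<^sup>2 / 2))"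

lemma reweight_measurable [measurable]: "reweight w \<in> borel_measurable borel"
  unfolding reweight_def by measurable

text \<open>Substituting x = mu + A z turns the quadratic form into the sum of w_i z_i^2, and the
  Jacobian |det A| cancels against the normalising factor. Dividing by the standard normal density
  leaves \<open>reweight w\<close>.\<close>

lemma gaussian_eq_distr:
  fixes A :: "real^'n^'n" and \<mu> :: "real^'n"
  assumes A: "invertible A" and w: "\<And>i. w i > 0"
  shows "gaussian \<mu> (A ** diagonal (\<lambda>i. 1 / w i) ** transpose A) =
    distr (density std_gaussian (\<lambda>z. ennreal (reweight w z))) borel (\<lambda>z. \<mu> + A *v z)"
proof -
  let ?S = "A ** diagonal (\<lambda>i. 1 / w i) ** transpose A"
  let ?T = "\<lambda>z. \<mu> + A *v z"
  define g where "g x = det ((2 * pi) *\<^sub>R ?S) powr (- 1 / 2) *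
      exp (- ((x - \<mu>) \<bullet> (matrix_inv ?S *v (x - \<mu>))) / 2)" for x
  have g_meas [measurable]: "g \<in> borel_measurable borel"
    unfolding g_def by measurable
  have T [measurable]: "?T \<in> borel_measurable borel" by measurable
  note wn = w[THEN less_imp_neq, symmetric] 
  have At: "invertible (transpose A)" using A by (rule transpose_invertible)
  have inv: "matrix_inv ?S = matrix_inv (transpose A) ** diagonal w ** matrix_inv A"
  proof (rule matrix_inv_unique)
    have "?S ** (matrix_inv (transpose A) ** diagonal w ** matrix_inv A) =
      A ** (diagonal (\<lambda>i. 1 / w i) ** (transpose A ** matrix_inv (transpose A)) ** diagonal w) ** matrix_inv A"
      by (simp only: matrix_mul_assoc)
    then show "?S ** (matrix_inv (transpose A) ** diagonal w ** matrix_inv A) = mat 1"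
      using wn by (simp add: invertible_matrix_inv A At diagonal_mul diagonal_1)
  qed
  have "transpose A ** matrix_inv ?S ** A = (transpose A ** matrix_inv (transpose A)) ** diagonal w ** (matrix_inv A ** A)"
    unfolding inv by (simp only: matrix_mul_assoc)
  then have "transpose A ** matrix_inv ?S ** A = diagonal w"
    by (simp add: invertible_matrix_inv A At)
  then have quad: "(A *v z) \<bullet> (matrix_inv ?S *v (A *v z)) = (\<Sum>i\<in>UNIV. w i * (z $ i)\<^sup>2)" for z
    using inner_congruence[of z A "matrix_inv ?S"]
    by (simp add: diagonal_mult_vec inner_vec_def power2_eq_square mult_ac)
  have "(2 * pi) *\<^sub>R ?S = A ** diagonal (\<lambda>i. 2 * pi / w i) ** transpose A"
  proof -
    have "A ** diagonal (\<lambda>i. 2 * pi / w i) = (2 * pi) *\<^sub>R (A ** diagonal (\<lambda>i. 1 / w i))"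
      by (simp add: vec_eq_iff matrix_mul_diagonal_nth)
    then show ?thesis by (simp add: scalar_matrix_assoc)
  qed
  \<comment> \<open>Written as the square of a positive number, so that the power -1/2 becomes a
    reciprocal.\<close>
  have det: "det ((2 * pi) *\<^sub>R ?S) = (\<bar>det A\<bar> * (\<Prod>i\<in>UNIV. sqrt (2 * pi / w i)))\<^sup>2"
  proof -
    have "(\<Prod>i\<in>UNIV. 2 * pi / w i) = (\<Prod>i\<in>UNIV. sqrt (2 * pi / w i)) * (\<Prod>i\<in>UNIV. sqrt (2 * pi / w i))"
      using w by (simp add: less_imp_le flip: prod.distrib)
    then show ?thesis
      by (simp add: \<open>(2 * pi) *\<^sub>R ?S = _\<close> det_mul det_diagonal_eq power_mult_distrib power2_eq_square)
  qed
  have detA: "\<bar>det A\<bar> > 0" using A by (simp add: invertible_det_nz)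
  have P: "(\<Prod>i\<in>UNIV. sqrt (2 * pi / w i)) > 0" using w by (intro prod_pos) simp
  have powr: "det ((2 * pi) *\<^sub>R ?S) powr (- 1 / 2) = 1 / (\<bar>det A\<bar> * (\<Prod>i\<in>UNIV. sqrt (2 * pi / w i)))"
  proof -
    have "x\<^sup>2 powr (- 1 / 2) = 1 / x" if "x > 0" for x :: real
    proof -
      have "x\<^sup>2 powr (1 / 2) = x" using that by (simp add: powr_half_sqrt)
      then show ?thesis by (simp add: powr_minus_divide)
    qed
    then show ?thesis unfolding det using detA P by simp
  qed
  have norm: "\<bar>det A\<bar> * det ((2 * pi) *\<^sub>R ?S) powr (- 1 / 2) = (\<Prod>i\<in>UNIV. 1 / sqrt (2 * pi / w i))"
    unfolding powr using detA P by (simp add: prod_dividef)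
  have key: "\<bar>det A\<bar> * g (?T z) = (\<Prod>i\<in>UNIV. std_normal_density (z $ i)) * reweight w z" for z
  proof -
    have "\<bar>det A\<bar> * g (?T z) =
      (\<bar>det A\<bar> * det ((2 * pi) *\<^sub>R ?S) powr (- 1 / 2)) * exp (- (\<Sum>i\<in>UNIV. w i * (z $ i)\<^sup>2) / 2)"
      by (simp only: g_def quad add_diff_cancel_left' mult.assoc)
    also have "\<dots> = (\<Prod>i\<in>UNIV. 1 / sqrt (2 * pi / w i)) * exp (\<Sum>i\<in>UNIV. - (w i * (z $ i)\<^sup>2) / 2)"
      by (simp only: norm sum_divide_distrib sum_negf[symmetric])
    also have "\<dots> = (\<Prod>i\<in>UNIV. 1 / sqrt (2 * pi / w i) * exp (- (w i * (z $ i)\<^sup>2) / 2))"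
      by (simp only: exp_sum[OF finite] prod.distrib)
    also have "\<dots> = (\<Prod>i\<in>UNIV. std_normal_density (z $ i) * (sqrt (w i) * exp ((1 - w i) * (z $ i)\<^sup>2 / 2)))"
    proof (rule prod.cong[OF refl])
      fix i
      have "exp (- (w i * (z $ i)\<^sup>2) / 2) = exp (- (z $ i)\<^sup>2 / 2) * exp ((1 - w i) * (z $ i)\<^sup>2 / 2)"
        by (simp add: exp_add[symmetric] field_simps)
      then show "1 / sqrt (2 * pi / w i) * exp (- (w i * (z $ i)\<^sup>2) / 2) =
        std_normal_density (z $ i) * (sqrt (w i) * exp ((1 - w i) * (z $ i)\<^sup>2 / 2))"
        by (simp add: std_normal_density_def real_sqrt_divide)
    qed
    finally show ?thesis by (simp add: reweight_def prod.distrib)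
  qed
  have "gaussian \<mu> ?S = density lborel (\<lambda>x. ennreal (g x))"
    by (simp add: gaussian_def g_def)
  also have "\<dots> = density (density (distr lborel borel ?T) (\<lambda>_. ennreal \<bar>det A\<bar>)) (\<lambda>x. ennreal (g x))"
    using lborel_affine_matrix[OF A, of \<mu>] by simp
  also have "\<dots> = density (distr lborel borel ?T) (\<lambda>x. ennreal (\<bar>det A\<bar> * g x))"
    by (subst density_density_eq) (simp_all add: ennreal_mult')
  also have "\<dots> = distr (density lborel (\<lambda>z. ennreal (\<bar>det A\<bar> * g (?T z)))) borel ?T"
    by (rule density_distr) simp_all
  also have "density lborel (\<lambda>z. ennreal (\<bar>det A\<bar> * g (?T z))) = density std_gaussian (\<lambda>z. ennreal (reweight w z))"
    unfolding key std_gaussian_eq_density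
    by (subst density_density_eq) (simp_all add: prod_ennreal prod_nonneg ennreal_mult')
  finally show ?thesis .
qed

lemma prob_space_std_gaussian: "prob_space std_gaussian"
proof -
  interpret prob_space "PiM UNIV (\<lambda>_. std_normal)"
    by (intro prob_space_PiM prob_space_std_normal)
  show ?thesis unfolding std_gaussian_def by (rule prob_space_distr) measurable
qed

text \<open>In each coordinate the factor times the standard normal density is the normal density of
  variance 1 / w_i; the product is integrated coordinate by coordinate.\<close>

lemma integral_reweight:
  assumes w: "\<And>i. w i > 0"
  shows "integrable std_gaussian (reweight w)" "(\<integral>x. reweight w x \<partial>std_gaussian) = 1"
proof -
  interpret product_sigma_finite "\<lambda>_::'a. std_normal"
    by (simp add: product_sigma_finite_def prob_space_imp_sigma_finite prob_space_std_normal)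
  define f where "f i x = sqrt (w i) * exp ((1 - w i) * x\<^sup>2 / 2)" for i x
  have [measurable]: "f i \<in> borel_measurable borel" for i unfolding f_def by measurable
  have eq: "std_normal_density x * f i x = normal_density 0 (1 / sqrt (w i)) x" for i x
  proof -
    have "exp (- (x\<^sup>2 * w i / 2)) = exp (- (x\<^sup>2 / 2)) * exp ((1 - w i) * x\<^sup>2 / 2)"
      by (simp add: exp_add[symmetric] field_simps)
    then show ?thesis
      using w[of i] by (simp add: f_def normal_density_def real_sqrt_divide power_divide)
  qed
  have f: "integrable std_normal (f i)" "(\<integral>x. f i x \<partial>std_normal) = 1" for i
    using w[of i] by (simp_all add: std_normal_integrable std_normal_integral eq)
  have r: "reweight w (vec_lambda x) = (\<Prod>i\<in>UNIV. f i (x i))" for x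
    by (simp add: reweight_def f_def)
  show "integrable std_gaussian (reweight w)"
    unfolding std_gaussian_def
    by (subst integrable_distr_eq) (simp_all add: r product_integrable_prod f)
  show "(\<integral>x. reweight w x \<partial>std_gaussian) = 1"
    unfolding std_gaussian_def
    by (subst integral_distr) (simp_all add: r product_integral_prod f)
qed

text \<open>The terms are independent on the product space with variances 2 c_i^2 and moment ratio
  15, and 15 * 2^2 = 60.\<close>

lemma std_gaussian_chi_square:
  fixes c :: "'n::finite \<Rightarrow> real"
  defines "W \<equiv> \<lambda>x :: real^'n. \<Sum>i\<in>UNIV. c i * ((x $ i)\<^sup>2 - 1)"
  shows "integrable std_gaussian (\<lambda>x. W x ^ n)"
    and "(\<integral>x. W x \<partial>std_gaussian) = 0"
    and "(\<integral>x. (W x)\<^sup>2 \<partial>std_gaussian) = 2 * (\<Sum>i\<in>UNIV. (c i)\<^sup>2)"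
    and "(\<integral>x. W x ^ 4 \<partial>std_gaussian) \<le> 60 * (\<Sum>i\<in>UNIV. (c i)\<^sup>2)\<^sup>2"
proof -
  let ?P = "PiM UNIV (\<lambda>_::'n. std_normal)"
  interpret prob_space ?P by (intro prob_space_PiM prob_space_std_normal)
  define X where "X i \<omega> = c i * ((\<omega> i)\<^sup>2 - 1)" for i and \<omega> :: "'n \<Rightarrow> real"
  have comp: "distr ?P std_normal (\<lambda>\<omega>. \<omega> i) = std_normal" for i
    by (rule distr_PiM_component) (auto intro: prob_space_std_normal)
  \<comment> \<open>Independence means that the joint law of the coordinates is the product of their
    laws; here both are the product measure itself.\<close>
  have "indep_vars (\<lambda>_. borel) (\<lambda>i \<omega>. \<omega> i) (UNIV :: 'n set)"
  proof (subst indep_vars_iff_distr_eq_PiM')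
    have "distr ?P (PiM UNIV (\<lambda>_. borel)) (\<lambda>x. \<lambda>i\<in>UNIV. x i) = ?P"
    proof -
      have "distr ?P (PiM UNIV (\<lambda>_. borel)) (\<lambda>x. \<lambda>i\<in>UNIV. x i) = distr ?P ?P (\<lambda>x. x)"
        by (rule distr_cong) (auto intro!: sets_PiM_cong)
      then show ?thesis by simp
    qed
    moreover have "distr ?P borel (\<lambda>\<omega>. \<omega> i) = std_normal" for i
      using comp[of i] by (simp cong: distr_cong)
    ultimately show "distr ?P (PiM UNIV (\<lambda>_. borel)) (\<lambda>x. \<lambda>i\<in>UNIV. x i) =
      PiM UNIV (\<lambda>i. distr ?P borel (\<lambda>\<omega>. \<omega> i))" by simp
  qed auto
  then have indep: "indep_vars (\<lambda>_. borel) X UNIV"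
    unfolding X_def by (rule indep_vars_compose2) measurable
  have tr: "integrable ?P (\<lambda>\<omega>. h (\<omega> i)) \<longleftrightarrow> integrable std_normal h"
    "expectation (\<lambda>\<omega>. h (\<omega> i)) = (\<integral>x. h x \<partial>std_normal)"
    if [measurable]: "h \<in> borel_measurable borel" for h :: "real \<Rightarrow> real" and i
    using integrable_distr_eq[of "\<lambda>\<omega>. \<omega> i" ?P std_normal h] integral_distr[of "\<lambda>\<omega>. \<omega> i" ?P std_normal h]
    by (simp_all add: comp)
  have "(\<forall>n. integrable ?P (\<lambda>\<omega>. (\<Sum>i\<in>UNIV. X i \<omega>) ^ n)) \<and>
    expectation (\<lambda>\<omega>. \<Sum>i\<in>UNIV. X i \<omega>) = 0 \<and>
    expectation (\<lambda>\<omega>. (\<Sum>i\<in>UNIV. X i \<omega>)\<^sup>2) = (\<Sum>i\<in>UNIV. 2 * (c i)\<^sup>2) \<and>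
    expectation (\<lambda>\<omega>. (\<Sum>i\<in>UNIV. X i \<omega>) ^ 4) \<le> 15 * (\<Sum>i\<in>UNIV. 2 * (c i)\<^sup>2)\<^sup>2"
  proof (rule moments_indep_sum[OF _ indep])
    show "integrable ?P (\<lambda>\<omega>. X i \<omega> ^ n)" for i n
      using tr(1)[of "\<lambda>x. (c i * (x\<^sup>2 - 1)) ^ n" i] std_normal_chi_square(1) by (simp add: X_def)
    show "expectation (X i) = 0" for i
      using tr(2)[of "\<lambda>x. c i * (x\<^sup>2 - 1)" i] std_normal_chi_square(2)[of "c i"]
      by (simp only: X_def[abs_def]) simp
    show "expectation (\<lambda>\<omega>. (X i \<omega>)\<^sup>2) = 2 * (c i)\<^sup>2" for i
      using tr(2)[of "\<lambda>x. (c i * (x\<^sup>2 - 1))\<^sup>2" i] std_normal_chi_square(3)[of "c i"] by (simp add: X_def)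
    show "expectation (\<lambda>\<omega>. X i \<omega> ^ 4) \<le> 15 * (2 * (c i)\<^sup>2)\<^sup>2" for i
    proof -
      have "expectation (\<lambda>\<omega>. X i \<omega> ^ 4) = 60 * c i ^ 4"
        using tr(2)[of "\<lambda>x. (c i * (x\<^sup>2 - 1)) ^ 4" i] std_normal_chi_square(4)[of "c i"]
        by (simp only: X_def) simp
      then show ?thesis by (simp add: power_mult_distrib)
    qed
  qed simp_all
  note mom = this[unfolded X_def]
  have W [measurable]: "W \<in> borel_measurable borel" unfolding W_def by measurable
  have Wv: "W (vec_lambda \<omega>) = (\<Sum>i\<in>UNIV. c i * ((\<omega> i)\<^sup>2 - 1))" for \<omega> by (simp add: W_def)
  have tr2: "integrable std_gaussian (\<lambda>x. W x ^ n) \<longleftrightarrow> integrable ?P (\<lambda>\<omega>. W (vec_lambda \<omega>) ^ n)"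
    "(\<integral>x. W x ^ n \<partial>std_gaussian) = expectation (\<lambda>\<omega>. W (vec_lambda \<omega>) ^ n)" for n
    unfolding std_gaussian_def by (simp_all add: integrable_distr_eq integral_distr)
  show "integrable std_gaussian (\<lambda>x. W x ^ n)"
    and "(\<integral>x. W x \<partial>std_gaussian) = 0"
    and "(\<integral>x. (W x)\<^sup>2 \<partial>std_gaussian) = 2 * (\<Sum>i\<in>UNIV. (c i)\<^sup>2)"
    and "(\<integral>x. W x ^ 4 \<partial>std_gaussian) \<le> 60 * (\<Sum>i\<in>UNIV. (c i)\<^sup>2)\<^sup>2"
    using mom tr2(1)[of n] tr2(2)[of 1] tr2(2)[of 2] tr2(2)[of 4]
    by (simp_all add: Wv sum_distrib_left[symmetric] power_mult_distrib)
qed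

subsection \<open>Bounds for the total variation\<close>

text \<open>The Weierstrass product inequality: a new factor 1 - y lowers the product by at most y,
  since the remaining product is at most 1.\<close>

lemma prod_one_minus_ge:
  fixes y :: "'i \<Rightarrow> real"
  assumes "finite I" "\<And>i. i \<in> I \<Longrightarrow> 0 \<le> y i \<and> y i \<le> 1"
  shows "1 - (\<Sum>i\<in>I. y i) \<le> (\<Prod>i\<in>I. 1 - y i)"
  using assms
proof (induction I rule: finite_induct)
  case (insert i I)
  have P: "0 \<le> (\<Prod>i\<in>I. 1 - y i)" "(\<Prod>i\<in>I. 1 - y i) \<le> 1"
    using insert.prems by (auto intro!: prod_nonneg prod_le_1)
  have "y i * (\<Prod>i\<in>I. 1 - y i) \<le> y i * 1"
    using P insert.prems[of i] by (intro mult_left_mono) auto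
  then show ?case
    using insert by (simp add: algebra_simps)
qed simp

section \<open>The normalised pair of densities\<close>

locale gaussian_ratio =
  fixes c :: "'n::finite \<Rightarrow> real"
  assumes c: "\<And>i. \<bar>c i\<bar> < 1"
begin

definition f :: "real^'n \<Rightarrow> real" where "f = reweight (\<lambda>i. 1 + c i)"
definition g :: "real^'n \<Rightarrow> real" where "g = reweight (\<lambda>i. 1 - c i)"

lemma c_pos: "0 < 1 + c i" "0 < 1 - c i" "(c i)\<^sup>2 < 1"
  using c[of i] by (auto simp: abs_less_iff abs_square_less_1)

sublocale density_pair std_gaussian f g
proof
  show "sets std_gaussian = sets (borel :: (real^'n) measure)" by (simp add: std_gaussian_def)
  show "integrable std_gaussian f" "integrable std_gaussian g"
    "(\<integral>x. f x \<partial>std_gaussian) = 1" "(\<integral>x. g x \<partial>std_gaussian) = 1"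
    unfolding f_def g_def using c_pos by (intro integral_reweight; simp)+
  show "0 \<le> f x" "0 \<le> g x" for x
    unfolding f_def g_def reweight_def using c_pos by (auto intro!: prod_nonneg mult_nonneg_nonneg simp: less_imp_le)
qed

sublocale G: prob_space "std_gaussian :: (real^'n) measure" by (rule prob_space_std_gaussian)

lemma fg_pos: "0 < f x" "0 < g x"
  unfolding f_def g_def reweight_def using c_pos by (auto intro!: prod_pos mult_pos_pos)

definition B :: real where "B = sqrt (\<Prod>i\<in>UNIV. sqrt (1 - (c i)\<^sup>2))"

text \<open>The exponents of f and g are - c_i x_i^2 / 2 and c_i x_i^2 / 2 and cancel, so only the
  normalising factors survive.\<close>

lemma affinity: "sqrt (f x * g x) = B"
proof -
  have "sqrt (1 + c i) * exp ((1 - (1 + c i)) * (x $ i)\<^sup>2 / 2) *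
        (sqrt (1 - c i) * exp ((1 - (1 - c i)) * (x $ i)\<^sup>2 / 2)) = sqrt (1 - (c i)\<^sup>2)" for i
  proof -
    have "exp ((1 - (1 + c i)) * (x $ i)\<^sup>2 / 2) * exp ((1 - (1 - c i)) * (x $ i)\<^sup>2 / 2) = 1"
      by (simp add: exp_add[symmetric])
    moreover have "sqrt (1 + c i) * sqrt (1 - c i) = sqrt (1 - (c i)\<^sup>2)"
      by (simp add: real_sqrt_mult[symmetric] algebra_simps power2_eq_square)
    moreover have "s * e * (s' * e') = (s * s') * (e * e')" for s e s' e' :: real
      by (simp only: mult_ac)
    ultimately show ?thesis by (simp only: mult_1_right)
  qed
  then have "f x * g x = (\<Prod>i\<in>UNIV. sqrt (1 - (c i)\<^sup>2))"
    by (simp only: f_def g_def reweight_def prod.distrib[symmetric])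
  then show ?thesis by (simp add: B_def)
qed

lemma integral_affinity: "(\<integral>x. sqrt (f x * g x) \<partial>std_gaussian) = B"
  using G.prob_space by (simp add: affinity)

lemma c_sq: "0 \<le> 1 - (c i)\<^sup>2" "1 - (c i)\<^sup>2 \<le> 1" "1 - (c i)\<^sup>2 \<le> sqrt (1 - (c i)\<^sup>2)"
proof -
  show 1: "0 \<le> 1 - (c i)\<^sup>2" "1 - (c i)\<^sup>2 \<le> 1" using c_pos(3)[of i] by auto
  have "1 - (c i)\<^sup>2 = sqrt ((1 - (c i)\<^sup>2) * (1 - (c i)\<^sup>2))" using 1 by simp
  also have "\<dots> \<le> sqrt (1 - (c i)\<^sup>2)"
    using 1 by (intro real_sqrt_le_mono) (simp add: mult_left_le_one_le)
  finally show "1 - (c i)\<^sup>2 \<le> sqrt (1 - (c i)\<^sup>2)" .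
qed

text \<open>For the third bound, B >= B^2 = prod sqrt(1 - c_i^2) >= prod (1 - c_i^2) >= 1 - sum
  c_i^2. For the last one, B^4 is a product of factors in [0, 1], hence at most any one of
  them.\<close>

lemma B_bounds: "0 \<le> B" "B \<le> 1" "1 - B \<le> (\<Sum>i\<in>UNIV. (c i)\<^sup>2)" "B ^ 4 \<le> 1 - (c i)\<^sup>2"
proof -
  let ?P = "\<Prod>i\<in>UNIV. sqrt (1 - (c i)\<^sup>2)"
  have P: "0 \<le> ?P" "?P \<le> 1"
    using c_sq by (auto intro!: prod_nonneg prod_le_1 simp: real_sqrt_le_1_iff)
  have B2: "B\<^sup>2 = ?P" using P by (simp add: B_def)
  show B0: "0 \<le> B" unfolding B_def using P by simp
  show B1: "B \<le> 1" unfolding B_def using P by simp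
  have "1 - (\<Sum>i\<in>UNIV. (c i)\<^sup>2) \<le> (\<Prod>i\<in>UNIV. 1 - (c i)\<^sup>2)"
    using c_sq by (intro prod_one_minus_ge) auto
  also have "\<dots> \<le> ?P" using c_sq by (intro prod_mono) auto
  also have "\<dots> \<le> B" unfolding B2[symmetric] using B0 B1 by (simp add: power2_eq_square mult_left_le_one_le)
  finally show "1 - B \<le> (\<Sum>i\<in>UNIV. (c i)\<^sup>2)" by simp
  have "B ^ 4 = ?P * ?P" unfolding B2[symmetric] by (simp add: power2_eq_square power4_eq_xxxx)
  also have "\<dots> = (\<Prod>i\<in>UNIV. 1 - (c i)\<^sup>2)" using c_sq by (simp flip: prod.distrib)
  also have "\<dots> = (1 - (c i)\<^sup>2) * (\<Prod>i\<in>UNIV - {i}. 1 - (c i)\<^sup>2)"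
    by (simp add: prod.remove[of UNIV i])
  also have "\<dots> \<le> (1 - (c i)\<^sup>2) * 1"
    using c_sq by (intro mult_left_mono prod_le_1) auto
  finally show "B ^ 4 \<le> 1 - (c i)\<^sup>2" by simp
qed

definition L :: real where "L = sqrt (\<Sum>i\<in>UNIV. (2 * c i / (1 - c i))\<^sup>2)"

lemma total_variation_le:
  assumes "L > 0"
  shows "total_variation P Q \<le> 3 / 2 * min 1 L"
proof -
  have "(c i)\<^sup>2 \<le> (2 * c i / (1 - c i))\<^sup>2" for i
  proof -
    have "\<bar>c i\<bar> * (1 - c i) \<le> \<bar>c i\<bar> * 2" using c[of i] by (intro mult_left_mono) auto
    then have "\<bar>c i\<bar> \<le> \<bar>2 * c i / (1 - c i)\<bar>"
      using c_pos(2)[of i] by (simp add: abs_mult pos_le_divide_eq mult.commute)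
    then show ?thesis by (simp only: abs_le_square_iff)
  qed
  then have "(\<Sum>i\<in>UNIV. (c i)\<^sup>2) \<le> L\<^sup>2"
    by (simp add: L_def sum_nonneg sum_mono)
  then have "1 - B \<le> L\<^sup>2" using B_bounds(3) by simp
  \<comment> \<open>With weight 2 / L, 1 - B <= L^2 and 1 + B <= 2, the bound is (2 L + L) / 2. The
    weight sqrt 2 / L would give sqrt 2 L; the rational weight is enough for 3/2.\<close>
  have "total_variation P Q \<le> (2 / L * (1 - B) + (1 + B) / (2 / L)) / 2"
    using total_variation_le_affinity[of "2 / L"] assms by (simp add: integral_affinity)
  also have "\<dots> \<le> (2 / L * L\<^sup>2 + 2 / (2 / L)) / 2"
    using assms B_bounds(2) \<open>1 - B \<le> L\<^sup>2\<close>
    by (intro divide_right_mono add_mono mult_left_mono) auto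
  also have "\<dots> = 3 / 2 * L" using assms by (simp add: power2_eq_square)
  finally show ?thesis using total_variation_le_1 by (auto simp: min_def)
qed

text \<open>The exponents differ by c_i x_i^2; splitting off c_i centres each term, and the constant
  collects the rest together with the normalising factors.\<close>

lemma ln_ratio:
  "ln (g x) - ln (f x) = (\<Sum>i\<in>UNIV. c i * ((x $ i)\<^sup>2 - 1)) +
     (\<Sum>i\<in>UNIV. c i + (ln (1 - c i) - ln (1 + c i)) / 2)"
proof -
  have ln: "ln (reweight w x) = (\<Sum>i\<in>UNIV. ln (w i) / 2 + (1 - w i) * (x $ i)\<^sup>2 / 2)"
    if "\<And>i. w i > 0" for w
    unfolding reweight_def using that
    by (subst ln_prod) (auto simp: ln_mult ln_sqrt less_imp_le less_imp_neq[symmetric])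
  show ?thesis
    unfolding f_def g_def using c_pos
    by (simp add: ln sum_subtractf[symmetric] sum.distrib[symmetric])
      (auto intro!: sum.cong simp: field_simps)
qed

lemma total_variation_ge:
  assumes "L > 0"
  shows "min 1 L / 100 \<le> total_variation P Q"
proof (cases "B \<le> 99 / 100")
  case True
  then have "1 / 100 \<le> total_variation P Q"
    using total_variation_ge_affinity by (simp add: integral_affinity)
  then show ?thesis by (auto simp: min_def)
next
  case False
  \<comment> \<open>Since (99/100)^4 > 24/25, every c_i^2 is below 1/25; then 1 - c_i >= 4/5 and
    |lambda_i| <= 5/2 |c_i|.\<close>
  have "(99 / 100 :: real) ^ 4 \<le> B ^ 4" using False by (intro power_mono) auto
  then have "(c i)\<^sup>2 \<le> (1 / 5)\<^sup>2" for i
    using B_bounds(4)[of i] by (simp add: power_divide)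
  then have c5: "\<bar>c i\<bar> \<le> 1 / 5" for i
    using abs_le_square_iff[of "c i" "1 / 5"] by simp
  define k where "k = sqrt (\<Sum>i\<in>UNIV. (c i)\<^sup>2)"
  have k2: "(\<Sum>i\<in>UNIV. (c i)\<^sup>2) = k\<^sup>2" by (simp add: k_def sum_nonneg)
  have "(2 * c i / (1 - c i))\<^sup>2 \<le> (5 / 2 * c i)\<^sup>2" for i
  proof -
    have "2 * \<bar>c i\<bar> \<le> 5 / 2 * \<bar>c i\<bar> * (1 - c i)"
    proof -
      have "5 / 2 * \<bar>c i\<bar> * (4 / 5) \<le> 5 / 2 * \<bar>c i\<bar> * (1 - c i)"
        using c5[of i] by (intro mult_left_mono) auto
      then show ?thesis by simp
    qed
    then have "\<bar>2 * c i / (1 - c i)\<bar> \<le> \<bar>5 / 2 * c i\<bar>"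
      using c_pos(2)[of i] by (simp add: abs_mult pos_divide_le_eq)
    then show ?thesis by (simp only: abs_le_square_iff)
  qed
  then have "(\<Sum>i\<in>UNIV. (2 * c i / (1 - c i))\<^sup>2) \<le> (\<Sum>i\<in>UNIV. (5 / 2 * c i)\<^sup>2)"
    by (rule sum_mono)
  also have "\<dots> = (5 / 2 * k)\<^sup>2"
    by (simp only: power_mult_distrib k2 flip: sum_distrib_left)
  finally have "L \<le> 5 / 2 * k"
    unfolding L_def by (intro real_le_lsqrt) (simp_all add: k_def sum_nonneg)
  then have k: "k > 0" using assms by simp
  define W where "W x = (\<Sum>i\<in>UNIV. c i * ((x $ i)\<^sup>2 - 1))" for x :: "real^'n"
  define s where "s = (\<Sum>i\<in>UNIV. c i + (ln (1 - c i) - ln (1 + c i)) / 2)"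
  note chi = std_gaussian_chi_square[of c, folded W_def]
  have iW: "integrable std_gaussian W" using chi(1)[of 1] by simp
  \<comment> \<open>The parameter is t = 5 k, close to the optimum sqrt 30 k for second moment 2 k^2
    and fourth moment 60 k^4.\<close>
  have "9 / 25 * k = (3 * (2 * k\<^sup>2) / (5 * k) - 60 * (k\<^sup>2)\<^sup>2 / (5 * k) ^ 3) / 2"
    using k by (simp add: field_simps power2_eq_square power3_eq_cube)
  also have "\<dots> \<le> (3 * G.expectation (\<lambda>x. (W x)\<^sup>2) / (5 * k) - G.expectation (\<lambda>x. W x ^ 4) / (5 * k) ^ 3) / 2"
    using chi(3,4) k unfolding k2 by (intro divide_right_mono diff_mono) auto
  also have "\<dots> \<le> G.expectation (\<lambda>x. \<bar>W x\<bar>)"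
    using iW chi(1) k by (intro G.expectation_abs_ge) auto
  also have "\<dots> \<le> 2 * G.expectation (\<lambda>x. \<bar>W x + s\<bar>)"
    using iW chi(2) by (rule G.expectation_abs_shift)
  finally have E: "9 / 50 * k \<le> G.expectation (\<lambda>x. \<bar>W x + s\<bar>)" by simp
  have "99 / 100 * (9 / 50 * k) \<le> B * G.expectation (\<lambda>x. \<bar>W x + s\<bar>)"
    using False E k by (intro mult_mono) auto
  also have "\<dots> = (\<integral>x. sqrt (f x * g x) * \<bar>ln (g x) - ln (f x)\<bar> \<partial>std_gaussian)"
    unfolding affinity ln_ratio by (simp add: W_def s_def)
  also have "\<dots> \<le> (\<integral>x. \<bar>f x - g x\<bar> \<partial>std_gaussian)"
  proof (rule integral_mono)
    show "integrable std_gaussian (\<lambda>x. sqrt (f x * g x) * \<bar>ln (g x) - ln (f x)\<bar>)"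
      unfolding affinity ln_ratio using iW by (simp flip: W_def)
  qed (use int abs_diff_ge_geometric_mean_log[OF fg_pos] in auto)
  \<comment> \<open>Half of 99/100 * 9/50 is well above 1/40, and 1/40 is what L <= 5/2 k turns into
    1/100.\<close>
  finally have "k / 40 \<le> total_variation P Q" using k by (simp add: total_variation_eq)
  then have "L / 100 \<le> total_variation P Q" using \<open>L \<le> 5 / 2 * k\<close> by simp
  then show ?thesis by (auto simp: min_def)
qed

end

lemma gaussian_total_variation_bounds:
  fixes S T :: "real^'n^'n" and \<mu> :: "real^'n"
  assumes S: "positive_definite S" and T: "positive_definite T" and "S \<noteq> T"
  defines "ratio \<equiv> total_variation (gaussian \<mu> S) (gaussian \<mu> T) /
    min 1 (sqrt (\<Sum>l\<in>#eigenvalues (matrix_inv S ** T - mat 1). l\<^sup>2))"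
  shows "1 / 100 \<le> ratio \<and> ratio \<le> 3 / 2"
proof -
  obtain A :: "real^'n^'n" and c where A: "invertible A" and c: "\<And>i. \<bar>c i\<bar> < 1"
    and SA: "S = A ** diagonal (\<lambda>i. 1 / (1 + c i)) ** transpose A"
    and TA: "T = A ** diagonal (\<lambda>i. 1 / (1 - c i)) ** transpose A"
    and sum: "(\<Sum>l\<in>#eigenvalues (matrix_inv S ** T - mat 1). l\<^sup>2) = (\<Sum>i\<in>UNIV. (2 * c i / (1 - c i))\<^sup>2)"
  proof (rule relative_diagonalization[OF S T], goal_cases)
    case (1 A c)
    show thesis by (rule 1(1)[of A c]) (fact 1)+
  qed
  interpret gaussian_ratio c by unfold_locales (rule c)
  \<comment> \<open>If all c_i vanish, both covariances equal A A^T. Positivity of L keeps the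
    denominator of the ratio away from 0.\<close>
  have "L \<noteq> 0"
  proof
    assume "L = 0"
    then have "(2 * c i / (1 - c i))\<^sup>2 = 0" for i
      by (simp add: L_def sum_nonneg_eq_0_iff)
    then have "2 * c i / (1 - c i) = 0" for i by (metis power_eq_0_iff)
    then have "c i = 0" for i using c_pos(2)[of i] by (metis divide_eq_0_iff less_irrefl mult_eq_0_iff zero_neq_numeral)
    then show False using \<open>S \<noteq> T\<close> SA TA by simp
  qed
  moreover have "L \<ge> 0" by (simp add: L_def sum_nonneg)
  ultimately have L: "L > 0" by simp
  let ?T = "\<lambda>z. \<mu> + A *v z"
  have "gaussian \<mu> S = distr P borel ?T" "gaussian \<mu> T = distr Q borel ?T"
    unfolding SA TA f_def g_def using A c_pos by (intro gaussian_eq_distr; simp)+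
  moreover have "total_variation (distr P borel ?T) (distr Q borel ?T) = total_variation P Q"
  proof (rule total_variation_distr[where G = "\<lambda>x. matrix_inv A *v (x - \<mu>)"])
    show "matrix_inv A *v (?T x - \<mu>) = x" for x
      using A by (simp add: matrix_vector_mul_assoc invertible_matrix_inv)
  qed (simp_all add: sets_M)
  ultimately have "ratio = total_variation P Q / min 1 L"
    by (simp add: ratio_def sum L_def)
  then show ?thesis
    using total_variation_le[OF L] total_variation_ge[OF L] L
    by (simp add: pos_le_divide_eq pos_divide_le_eq)
qed

subsection \<open>Degenerate Gaussians\<close>

text \<open>If S = R R^T, both sides are images of the standard Gaussian, under R and then A on the
  left and under A R on the right.\<close>

lemma gaussian_linear_image:
  fixes S A :: "real^'n^'n"
  assumes S: "positive_definite S" and A: "invertible A"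
  shows "distr (gaussian 0 S) borel ((*v) A) = gaussian 0 (A ** S ** transpose A)"
proof -
  obtain R :: "real^'n^'n" where R: "invertible R" "S = R ** transpose R"
    using simultaneous_diagonalization[OF S S] by metis
  have g: "gaussian 0 (B ** transpose B) =
      distr (density std_gaussian (\<lambda>z. ennreal (reweight (\<lambda>_. 1) z))) borel ((*v) B)"
    if "invertible B" for B :: "real^'n^'n"
    using gaussian_eq_distr[OF that, of "\<lambda>_. 1" 0] by (simp add: diagonal_1)
  have "A ** S ** transpose A = (A ** R) ** transpose (A ** R)"
    by (simp only: R(2) matrix_transpose_mul matrix_mul_assoc)
  moreover have "invertible (A ** R)" using A R(1) by (rule invertible_mult)
  ultimately show ?thesis
    by (simp only: g) (simp add: R(2) g[OF R(1)] distr_distr o_def matrix_vector_mul_assoc std_gaussian_def)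
qed

lemma positive_definite_imp_invertible:
  fixes S :: "real^'n^'n"
  assumes "positive_definite S"
  shows "invertible S"
proof -
  have "x = 0" if "S *v x = 0" for x
    using assms that unfolding positive_definite_def by (metis inner_zero_right less_irrefl)
  then have "\<exists>B. B ** S = mat 1" by (simp add: matrix_left_invertible_ker)
  then show ?thesis by (simp add: invertible_left_inverse)
qed

text \<open>Since U^T U = 1, the exponent evaluated at mu + U y is that of the nondegenerate
  Gaussian with covariance U^T S U on the r-dimensional space.\<close>

lemma degenerate_gaussian_eq_distr:
  fixes U :: "real^'r^'n" and S :: "real^'n^'n"
  assumes U: "transpose U ** U = mat 1"
  shows "degenerate_gaussian U \<mu> S = distr (gaussian 0 (transpose U ** S ** U)) borel (\<lambda>y. \<mu> + U *v y)"
proof -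
  let ?S = "transpose U ** S ** U"
  have "(U *v y) \<bullet> ((U ** matrix_inv ?S ** transpose U) *v (U *v y)) = y \<bullet> (matrix_inv ?S *v y)" for y
    using inner_congruence[of "U *v y" "transpose U" "matrix_inv ?S"]
    by (simp only: transpose_transpose matrix_vector_mul_assoc[of "transpose U"] U matrix_vector_mul_lid)
  then show ?thesis
    unfolding degenerate_gaussian_def gaussian_def affine_lborel_def Let_def
    by (subst density_distr) simp_all
qed

text \<open>Each column of P is a combination of columns of U, and the coefficients form X. Range
  inclusions thereby become matrix identities.\<close>

lemma matrix_range_subset_factor:
  fixes P :: "real^'r^'n" and U :: "real^'s^'n"
  assumes "matrix_range P \<subseteq> matrix_range U"
  obtains X where "P = U ** X"
proof -
  have "subspace (range ((*v) U))"
    by (intro linear_subspace_image matrix_vector_mul_linear subspace_UNIV)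
  moreover have "columns U \<subseteq> range ((*v) U)"
    by (auto simp: columns_def simp flip: matrix_vector_mult_basis)
  ultimately have "span (columns U) \<subseteq> range ((*v) U)" by (simp add: span_minimal)
  moreover have "column j P \<in> span (columns P)" for j
    by (rule span_base) (auto simp: columns_def)
  ultimately have "\<exists>x. column j P = U *v x" for j
    using assms unfolding matrix_range_def by blast
  then obtain x where x: "\<And>j. column j P = U *v x j" by metis
  have "P = U ** (\<chi> i j. x j $ i)"
  proof -
    have "P $ i $ j = (U *v x j) $ i" for i j
      unfolding x[symmetric] by (simp add: column_def)
    then show ?thesis by (simp add: vec_eq_iff matrix_matrix_mult_def matrix_vector_mult_def)
  qed
  then show ?thesis by (rule that)
qed

text \<open>The quadratic form attains its minimum 0 at x, and its derivative there in the direction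
  S x is 2 |S x|^2.\<close>

lemma positive_semidefinite_null:
  fixes S :: "real^'n^'n"
  assumes S: "positive_semidefinite S" and x: "x \<bullet> (S *v x) = 0"
  shows "S *v x = 0"
proof -
  have sym: "transpose S = S" and nn: "\<And>x. 0 \<le> x \<bullet> (S *v x)"
    using S by (auto simp: positive_semidefinite_def)
  let ?w = "S *v x"
  have "2 * (?w \<bullet> ?w) = 0"
  proof (rule quadratic_nonneg_linear_coeff_zero)
    fix t
    have "0 \<le> (x + t *\<^sub>R ?w) \<bullet> (S *v (x + t *\<^sub>R ?w))" by (rule nn)
    also have "\<dots> = 2 * (?w \<bullet> ?w) * t + ?w \<bullet> (S *v ?w) * t\<^sup>2"
      using symmetric_matrix_inner[OF sym, of x ?w] x
      by (simp add: matrix_vector_right_distrib matrix_vector_mult_scaleR inner_add power2_eq_square algebra_simps)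
    finally show "0 \<le> 2 * (?w \<bullet> ?w) * t + ?w \<bullet> (S *v ?w) * t\<^sup>2" .
  qed
  then show ?thesis by simp
qed

text \<open>U U^T fixes the range of S, hence U U^T S = S, and transposing gives S U U^T = S. So U^T
  S U determines S, and distinct covariances have distinct compressions.\<close>

lemma compression_eq:
  fixes U :: "real^'r^'n" and S :: "real^'n^'n"
  assumes U: "orthonormal_basis_matrix U (matrix_range S)" and S: "transpose S = S"
  shows "U ** (transpose U ** S ** U) ** transpose U = S"
proof -
  have UU: "transpose U ** U = mat 1" and r: "matrix_range S \<subseteq> matrix_range U"
    using U by (auto simp: orthonormal_basis_matrix_def)
  obtain X where X: "S = U ** X" by (rule matrix_range_subset_factor[OF r])
  have "U ** transpose U ** S = U ** (transpose U ** U) ** X"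
    unfolding X by (simp only: matrix_mul_assoc)
  then have 1: "U ** transpose U ** S = S" by (simp add: UU X)
  then have "transpose (U ** transpose U ** S) = S" by (simp add: S)
  then have "S ** U ** transpose U = S" by (simp add: matrix_transpose_mul S matrix_mul_assoc)
  with 1 show ?thesis by (simp add: matrix_mul_assoc)
qed

text \<open>If the form vanishes at U y, then U y lies in the kernel of S. It also lies in the range
  of S, which is orthogonal to the kernel by symmetry, so U y = 0 and y = 0.\<close>

lemma positive_definite_compression:
  fixes U :: "real^'r^'n" and S :: "real^'n^'n"
  assumes U: "orthonormal_basis_matrix U (matrix_range S)" and S: "positive_semidefinite S"
  shows "positive_definite (transpose U ** S ** U)"
  unfolding positive_definite_def
proof (intro conjI allI impI)
  have sym: "transpose S = S" using S by (simp add: positive_semidefinite_def)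
  then show "transpose (transpose U ** S ** U) = transpose U ** S ** U"
    by (simp add: matrix_transpose_mul matrix_mul_assoc)
  have UU: "transpose U ** U = mat 1" and r: "matrix_range U \<subseteq> matrix_range S"
    using U by (auto simp: orthonormal_basis_matrix_def)
  obtain Y where Y: "U = S ** Y" by (rule matrix_range_subset_factor[OF r])
  fix y :: "real^'r" assume "y \<noteq> 0"
  have "(U *v y) \<bullet> (S *v (U *v y)) \<noteq> 0"
  proof
    assume "(U *v y) \<bullet> (S *v (U *v y)) = 0"
    from positive_semidefinite_null[OF S this] have z: "S *v (U *v y) = 0" .
    have "U *v y = S *v (Y *v y)" by (simp add: Y matrix_vector_mul_assoc)
    then have "(U *v y) \<bullet> (U *v y) = (U *v y) \<bullet> (S *v (Y *v y))" by simp
    also have "\<dots> = 0" by (simp add: symmetric_matrix_inner[OF sym] z)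
    finally have "transpose U *v (U *v y) = 0" by simp
    then have "y = 0" by (simp only: matrix_vector_mul_assoc UU matrix_vector_mul_lid)
    with \<open>y \<noteq> 0\<close> show False by simp
  qed
  moreover have "0 \<le> (U *v y) \<bullet> (S *v (U *v y))"
    using S by (simp add: positive_semidefinite_def)
  ultimately show "0 < y \<bullet> ((transpose U ** S ** U) *v y)"
    by (simp only: inner_congruence)
qed

text \<open>Two orthonormal bases of the range differ by an orthogonal X, and X carries one
  r-dimensional Gaussian to the other. This allows a single U for both covariances although each
  comes with its own basis.\<close>

lemma degenerate_gaussian_basis_independent:
  fixes U V :: "real^'r^'n" and S :: "real^'n^'n"
  assumes U: "orthonormal_basis_matrix U (matrix_range S)"
    and V: "orthonormal_basis_matrix V (matrix_range S)" and S: "positive_semidefinite S"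
  shows "degenerate_gaussian V \<mu> S = degenerate_gaussian U \<mu> S"
proof -
  have UU: "transpose U ** U = mat 1" and VV: "transpose V ** V = mat 1"
    and r: "matrix_range V \<subseteq> matrix_range U"
    using U V by (auto simp: orthonormal_basis_matrix_def)
  obtain X where X: "V = U ** X" by (rule matrix_range_subset_factor[OF r])
  have "transpose V ** V = transpose X ** (transpose U ** U) ** X"
    unfolding X by (simp only: matrix_transpose_mul matrix_mul_assoc)
  then have XX: "transpose X ** X = mat 1" by (simp add: UU VV)
  then have XX': "X ** transpose X = mat 1" by (simp add: matrix_left_right_inverse)
  have iX: "invertible X" using XX XX' by (auto simp: invertible_def)
  have pd: "positive_definite (transpose V ** S ** V)"
    using positive_definite_compression[OF V S] .
  have "X ** (transpose V ** S ** V) ** transpose X =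
      (X ** transpose X) ** (transpose U ** S ** U) ** (X ** transpose X)"
    unfolding X by (simp only: matrix_transpose_mul matrix_mul_assoc)
  then have "gaussian 0 (transpose U ** S ** U) = distr (gaussian 0 (transpose V ** S ** V)) borel ((*v) X)"
    by (simp add: gaussian_linear_image[OF pd iX] XX')
  then show ?thesis
    unfolding degenerate_gaussian_eq_distr[OF UU] degenerate_gaussian_eq_distr[OF VV]
    by (simp add: distr_distr o_def X matrix_vector_mul_assoc gaussian_def)
qed

lemma degenerate_gaussian_total_variation_bounds:
  fixes S T :: "real^'n^'n" and P U V :: "real^'r^'n" and \<mu> :: "real^'n"
  assumes S: "positive_semidefinite S" and T: "positive_semidefinite T" and "S \<noteq> T"
    and range: "matrix_range S = matrix_range T" "matrix_range P = matrix_range S"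
    and U: "orthonormal_basis_matrix U (matrix_range S)"
    and V: "orthonormal_basis_matrix V (matrix_range T)"
  defines "ratio \<equiv> total_variation (degenerate_gaussian U \<mu> S) (degenerate_gaussian V \<mu> T) /
    min 1 (sqrt (\<Sum>l\<in>#eigenvalues (matrix_inv (transpose P ** S ** P) ** (transpose P ** T ** P) - mat 1). l\<^sup>2))"
  shows "1 / 100 \<le> ratio \<and> ratio \<le> 3 / 2"
proof -
  have UT: "orthonormal_basis_matrix U (matrix_range T)" using U range by simp
  let ?S = "transpose U ** S ** U" and ?T = "transpose U ** T ** U"
  have UU: "transpose U ** U = mat 1" using U by (simp add: orthonormal_basis_matrix_def)
  have pS: "positive_definite ?S" and pT: "positive_definite ?T"
    using positive_definite_compression[OF U S] positive_definite_compression[OF UT T] by auto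
  have "transpose S = S" "transpose T = T" using S T by (auto simp: positive_semidefinite_def)
  then have "U ** ?S ** transpose U = S" "U ** ?T ** transpose U = T"
    using compression_eq[OF U] compression_eq[OF UT] by blast+
  then have "?S \<noteq> ?T" using \<open>S \<noteq> T\<close> by auto
  have tv: "total_variation (degenerate_gaussian U \<mu> S) (degenerate_gaussian V \<mu> T) =
    total_variation (gaussian 0 ?S) (gaussian 0 ?T)"
    unfolding degenerate_gaussian_basis_independent[OF UT V T] degenerate_gaussian_eq_distr[OF UU]
  proof (rule total_variation_distr[where G = "\<lambda>x. transpose U *v (x - \<mu>)"])
    show "transpose U *v (\<mu> + U *v x - \<mu>) = x" for x
      by (simp only: add_diff_cancel_left' matrix_vector_mul_assoc UU matrix_vector_mul_lid)
    show "(\<lambda>x. transpose U *v (x - \<mu>)) \<in> borel_measurable borel"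
      by (rule measurable_compose[OF _ matrix_vector_mult_measurable]) simp
  qed (simp_all add: gaussian_def)
  have PU: "matrix_range P \<subseteq> matrix_range U" and UP: "matrix_range U \<subseteq> matrix_range P"
    using U range by (auto simp: orthonormal_basis_matrix_def)
  \<comment> \<open>P and U span the same space, so P = U C and U = P D; cancelling U gives C D = 1.
    Passing from U to P is then a congruence by the invertible C, which leaves the relative
    eigenvalues alone.\<close>
  obtain C where C: "P = U ** C" by (rule matrix_range_subset_factor[OF PU])
  obtain D where D: "U = P ** D" by (rule matrix_range_subset_factor[OF UP])
  have "transpose U ** U = transpose U ** (P ** D)" using D by simp
  also have "\<dots> = (transpose U ** U) ** C ** D"
    by (simp only: C matrix_mul_assoc)
  finally have "transpose U ** U = (transpose U ** U) ** C ** D" .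
  then have "C ** D = mat 1" by (simp add: UU)
  then have iC: "invertible C" by (auto simp: invertible_right_inverse)
  have P: "transpose P ** M ** P = transpose C ** (transpose U ** M ** U) ** C" for M
    unfolding C by (simp only: matrix_transpose_mul matrix_mul_assoc)
  have iS: "invertible ?S"
    by (rule positive_definite_imp_invertible[OF pS])
  have "ratio = total_variation (gaussian 0 ?S) (gaussian 0 ?T) /
    min 1 (sqrt (\<Sum>l\<in>#eigenvalues (matrix_inv ?S ** ?T - mat 1). l\<^sup>2))"
    unfolding ratio_def tv P eigenvalues_relative_congruence[OF iC iS] ..
  then show ?thesis
    using gaussian_total_variation_bounds[OF pS pT \<open>?S \<noteq> ?T\<close>, of 0] by simp
qed

text \<open>The rank r is carried by the type \<open>'r\<close> and is therefore at least 1. Rank 0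
  would make both covariances zero, contrary to their being distinct.\<close>

theorem theorem1p1:
  fixes \<mu> :: "real^'d"
  shows
    "(\<forall>\<Sigma>\<^sub>1 \<Sigma>\<^sub>2 :: real^'d^'d.
        positive_definite \<Sigma>\<^sub>1 \<and> positive_definite \<Sigma>\<^sub>2 \<and> \<Sigma>\<^sub>1 \<noteq> \<Sigma>\<^sub>2 \<longrightarrow>
        (let ratio =
           total_variation (gaussian \<mu> \<Sigma>\<^sub>1) (gaussian \<mu> \<Sigma>\<^sub>2) /
           min 1 (sqrt (\<Sum>l\<in>#eigenvalues (matrix_inv \<Sigma>\<^sub>1 ** \<Sigma>\<^sub>2 - mat 1). l\<^sup>2))
         in 1 / 100 \<le> ratio \<and> ratio \<le> 3 / 2))
     \<and>
     (\<forall>(\<Sigma>\<^sub>1 :: real^'d^'d) (\<Sigma>\<^sub>2 :: real^'d^'d)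
        (P :: real^'r^'d) (U\<^sub>1 :: real^'r^'d) (U\<^sub>2 :: real^'r^'d).
        positive_semidefinite \<Sigma>\<^sub>1 \<and> positive_semidefinite \<Sigma>\<^sub>2 \<and> \<Sigma>\<^sub>1 \<noteq> \<Sigma>\<^sub>2 \<and>
        matrix_range \<Sigma>\<^sub>1 = matrix_range \<Sigma>\<^sub>2 \<and>
        CARD('r) = rank \<Sigma>\<^sub>1 \<and>
        matrix_range P = matrix_range \<Sigma>\<^sub>1 \<and>
        orthonormal_basis_matrix U\<^sub>1 (matrix_range \<Sigma>\<^sub>1) \<and>
        orthonormal_basis_matrix U\<^sub>2 (matrix_range \<Sigma>\<^sub>2) \<longrightarrow>
        (let ratio =
           total_variation (degenerate_gaussian U\<^sub>1 \<mu> \<Sigma>\<^sub>1) (degenerate_gaussian U\<^sub>2 \<mu> \<Sigma>\<^sub>2) /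
           min 1 (sqrt (\<Sum>l\<in>#eigenvalues
             (matrix_inv (transpose P ** \<Sigma>\<^sub>1 ** P) ** (transpose P ** \<Sigma>\<^sub>2 ** P) - mat 1). l\<^sup>2))
         in 1 / 100 \<le> ratio \<and> ratio \<le> 3 / 2))"
proof (intro conjI allI impI, goal_cases)
  case (1 S T)
  then show ?case
    unfolding Let_def by (intro gaussian_total_variation_bounds) auto
next
  case (2 S T P U V)
  then show ?case
    unfolding Let_def by (intro degenerate_gaussian_total_variation_bounds) auto
qed

end
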